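(* Let $\Omega$ be a finite $D$-set. Then $\Omega$ is isomorphic to the set of leaves of a finite tree $T$ with no vertices of degree $2$, equipped with the relation $D(ab;cd)$ which holds iff the path in $T$ from $a$ to $b$ is disjoint from the path from $c$ to $d$. Furthermore, such a tree is unique up to isomorphism, and (identifying $\Omega$ with the leaves of $T$): (1) the map sending an inner vertex $\mu$ of $T$ to the partition of the leaves given by the connected components of $T\setminus\{\mu\}$ is a bijection between the inner vertices of $T$ and the splittings of $\Omega$ with three or more sectors, sending vertices of degree $d$ to splittings with $d$ sectors; (2) the map sending an edge $\epsilon$ of $T$ to the partition of the leaves given by the connected components of $T\setminus\{\epsilon\}$ is a bijection between the edges of $T$ and the splittings of $\Omega$ with two sectors.
   Context: A $D$-set is a set $\Omega$ with a quaternary relation $D$, written $D(wx;yz)$, such that for all $w,x,y,z\in\Omega$: (D1) $D(wx;yz)\to (D(xw;yz)\wedge D(yz;wx))$; (D2) $D(wx;yz)\to\neg D(wy;xz)$; (D3) $D(wx;yz)\to\forall v\,(D(vx;yz)\vee D(wx;yv))$; (D4) $(w\neq y\wedge x\neq y)\to D(wx;yy)$. A splitting of $\Omega$ is a partition of $\Omega$ into at least two parts (sectors) such that (i) if $a,b$ lie in a part $\Sigma$ and $c,d\in\Omega\setminus\Sigma$ then $D(ab;cd)$, and (ii) if $a,b,c,d$ lie in four distinct parts then $\neg D(ab;cd)$. Leaves of a tree are its vertices of degree at most $1$; inner vertices are the others. *)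

theory Defs
  imports Main "HOL-Library.Disjoint_Sets"
begin

section \<open>D-sets and splittings\<close>

text \<open>\<open>D w x y z\<close> stands for $D(wx;yz)$. Values of \<open>D\<close> outside \<open>\<Omega>\<close> are irrelevant.\<close>

definition D_set :: "'a set \<Rightarrow> ('a \<Rightarrow> 'a \<Rightarrow> 'a \<Rightarrow> 'a \<Rightarrow> bool) \<Rightarrow> bool" where
  "D_set \<Omega> D \<longleftrightarrow> (\<forall>w\<in>\<Omega>. \<forall>x\<in>\<Omega>. \<forall>y\<in>\<Omega>. \<forall>z\<in>\<Omega>.
     (D w x y z \<longrightarrow> D x w y z \<and> D y z w x) \<and>
     (D w x y z \<longrightarrow> \<not> D w y x z) \<and>
     (D w x y z \<longrightarrow> (\<forall>v\<in>\<Omega>. D v x y z \<or> D w x y v)) \<and>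
     (w \<noteq> y \<and> x \<noteq> y \<longrightarrow> D w x y y))"

definition D_isomorphism ::
  "'a set \<Rightarrow> ('a \<Rightarrow> 'a \<Rightarrow> 'a \<Rightarrow> 'a \<Rightarrow> bool) \<Rightarrow>
   'b set \<Rightarrow> ('b \<Rightarrow> 'b \<Rightarrow> 'b \<Rightarrow> 'b \<Rightarrow> bool) \<Rightarrow> ('a \<Rightarrow> 'b) \<Rightarrow> bool" where
  "D_isomorphism \<Omega> D \<Omega>' D' f \<longleftrightarrow>
     bij_betw f \<Omega> \<Omega>' \<and>
     (\<forall>a\<in>\<Omega>. \<forall>b\<in>\<Omega>. \<forall>c\<in>\<Omega>. \<forall>d\<in>\<Omega>. D a b c d \<longleftrightarrow> D' (f a) (f b) (f c) (f d))"

definition splitting ::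
  "'a set \<Rightarrow> ('a \<Rightarrow> 'a \<Rightarrow> 'a \<Rightarrow> 'a \<Rightarrow> bool) \<Rightarrow> 'a set set \<Rightarrow> bool" where
  "splitting \<Omega> D P \<longleftrightarrow>
     partition_on \<Omega> P \<and>
     (\<exists>A\<in>P. \<exists>B\<in>P. A \<noteq> B) \<and>
     (\<forall>S\<in>P. \<forall>a\<in>S. \<forall>b\<in>S. \<forall>c\<in>\<Omega> - S. \<forall>d\<in>\<Omega> - S. D a b c d) \<and>
     (\<forall>A\<in>P. \<forall>B\<in>P. \<forall>C\<in>P. \<forall>E\<in>P. distinct [A, B, C, E] \<longrightarrow>
        (\<forall>a\<in>A. \<forall>b\<in>B. \<forall>c\<in>C. \<forall>d\<in>E. \<not> D a b c d))"

section \<open>Simple graphs and trees\<close>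

record 'v ugraph =
  vertices :: "'v set"
  edges :: "'v set set"

definition simple_graph :: "'v ugraph \<Rightarrow> bool" where
  "simple_graph G \<longleftrightarrow> (\<forall>e\<in>edges G. e \<subseteq> vertices G \<and> card e = 2)"

definition finite_graph :: "'v ugraph \<Rightarrow> bool" where
  "finite_graph G \<longleftrightarrow> finite (vertices G) \<and> finite (edges G)"

definition degree :: "'v ugraph \<Rightarrow> 'v \<Rightarrow> nat" where
  "degree G v = card {e \<in> edges G. v \<in> e}"

definition walk :: "'v ugraph \<Rightarrow> 'v \<Rightarrow> 'v list \<Rightarrow> 'v \<Rightarrow> bool" where
  "walk G u p v \<longleftrightarrow>
     p \<noteq> [] \<and> hd p = u \<and> last p = v \<and> set p \<subseteq> vertices G \<and>
     successively (\<lambda>x y. {x, y} \<in> edges G) p"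

definition upath :: "'v ugraph \<Rightarrow> 'v \<Rightarrow> 'v list \<Rightarrow> 'v \<Rightarrow> bool" where
  "upath G u p v \<longleftrightarrow> walk G u p v \<and> distinct p"

definition ucycle :: "'v ugraph \<Rightarrow> 'v list \<Rightarrow> bool" where
  "ucycle G p \<longleftrightarrow> 3 \<le> length p \<and> upath G (hd p) p (last p) \<and> {last p, hd p} \<in> edges G"

definition connected_graph :: "'v ugraph \<Rightarrow> bool" where
  "connected_graph G \<longleftrightarrow> (\<forall>u\<in>vertices G. \<forall>v\<in>vertices G. \<exists>p. walk G u p v)"

text \<open>The graph without vertices counts as a tree; it represents the empty D-set.\<close>

definition tree :: "'v ugraph \<Rightarrow> bool" where
  "tree G \<longleftrightarrow> simple_graph G \<and> connected_graph G \<and> (\<nexists>p. ucycle G p)"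

definition components :: "'v ugraph \<Rightarrow> 'v set set" where
  "components G = (\<lambda>u. {v. \<exists>p. walk G u p v}) ` vertices G"

definition delete_vertex :: "'v ugraph \<Rightarrow> 'v \<Rightarrow> 'v ugraph" where
  "delete_vertex G v = \<lparr>vertices = vertices G - {v}, edges = {e \<in> edges G. v \<notin> e}\<rparr>"

definition delete_edge :: "'v ugraph \<Rightarrow> 'v set \<Rightarrow> 'v ugraph" where
  "delete_edge G e = \<lparr>vertices = vertices G, edges = edges G - {e}\<rparr>"

definition graph_isomorphism :: "'v ugraph \<Rightarrow> 'w ugraph \<Rightarrow> ('v \<Rightarrow> 'w) \<Rightarrow> bool" where
  "graph_isomorphism G H g \<longleftrightarrow>
     bij_betw g (vertices G) (vertices H) \<and>
     (\<forall>u\<in>vertices G. \<forall>v\<in>vertices G. {u, v} \<in> edges G \<longleftrightarrow> {g u, g v} \<in> edges H)"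

definition leaves :: "'v ugraph \<Rightarrow> 'v set" where
  "leaves G = {v \<in> vertices G. degree G v \<le> 1}"

definition inner_vertices :: "'v ugraph \<Rightarrow> 'v set" where
  "inner_vertices G = vertices G - leaves G"

definition the_path :: "'v ugraph \<Rightarrow> 'v \<Rightarrow> 'v \<Rightarrow> 'v list" where
  "the_path G u v = (THE p. upath G u p v)"

definition leaf_D :: "'v ugraph \<Rightarrow> 'v \<Rightarrow> 'v \<Rightarrow> 'v \<Rightarrow> 'v \<Rightarrow> bool" where
  "leaf_D G a b c d \<longleftrightarrow> set (the_path G a b) \<inter> set (the_path G c d) = {}"

section \<open>Representing a D-set by a tree\<close>

definition represents ::
  "'a set \<Rightarrow> ('a \<Rightarrow> 'a \<Rightarrow> 'a \<Rightarrow> 'a \<Rightarrow> bool) \<Rightarrow> 'v ugraph \<Rightarrow> ('a \<Rightarrow> 'v) \<Rightarrow> bool" where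
  "represents \<Omega> D T f \<longleftrightarrow>
     tree T \<and> finite_graph T \<and> (\<forall>v\<in>vertices T. degree T v \<noteq> 2) \<and>
     D_isomorphism \<Omega> D (leaves T) (leaf_D T) f"

text \<open>
  The family of subsets of \<open>\<Omega>\<close> cut out by the components of \<open>G\<close>, where \<open>f\<close> is the
  identification of \<open>\<Omega>\<close> with the leaves of the tree from which \<open>G\<close> arises by a deletion.
\<close>

definition induced_partition :: "'a set \<Rightarrow> ('a \<Rightarrow> 'v) \<Rightarrow> 'v ugraph \<Rightarrow> 'a set set" where
  "induced_partition \<Omega> f G = (\<lambda>C. {x \<in> \<Omega>. f x \<in> C}) ` components G"

end

theory Submission
  imports Defs
begin

text \<open>
  Call one side \<open>A\<close> of a splitting with two sectors a cut. The axioms imply that \<open>D(ab;cd)\<close>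
  holds iff some cut separates \<open>a, b\<close> from \<open>c, d\<close>, and that the cuts avoiding a fixed
  point \<open>r\<close> form a laminar family. The Hasse diagram of this family, with \<open>\<Omega>\<close> added on top to
  play the role of the leaf \<open>r\<close>, is a representing tree.

  In any representing tree, disjointness of two paths means that some edge separates them. So
  the edges yield a laminar family of cuts that already witnesses all instances of \<open>D\<close>, and such a
  family contains every cut. Distinct directed edges yield distinct cuts because no
  vertex has degree 2. Two splittings with at least three sectors that share a sector
  coincide, hence a splitting is the one at the vertex where the edge of any of its sectors
  starts. Adjacency can be read off the partitions at the vertices, which gives uniqueness.
\<close>

section \<open>Connectivity and paths\<close>

text \<open>Two cuts are comparable only if some point lies in both and some point lies outside
  both. Fixing \<open>r\<close> supplies the outer point and selects one side of every complementary
  pair; this is what roots the construction. Axiom (D3) enters only in passing from an instance of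
  \<open>D\<close> to a cut; after that only cuts and the other axioms are used. On the tree side,
  path disjointness is traded early for reachability after deleting an edge. The main obstacle is
  that an instance of \<open>D\<close> separates just two points from two others, whereas a cut
  separates all its points at once. Finiteness bridges the gap: unions and intersections of finite
  nonempty chains of cuts belong to the chain. Edges are handled as ordered pairs
  \<open>(v, w)\<close>. An edge carries two complementary cuts, and both the vertex of a splitting
  and adjacency require knowing from which end a cut is seen.\<close>

definition conn :: "'v ugraph \<Rightarrow> 'v \<Rightarrow> 'v \<Rightarrow> bool" where
  "conn G u v \<longleftrightarrow> (\<exists>p. walk G u p v)"

lemma conn_vertices: "conn G u v \<Longrightarrow> u \<in> vertices G \<and> v \<in> vertices G"
  unfolding conn_def walk_def by (metis hd_in_set last_in_set subsetD)

lemma conn_refl: "v \<in> vertices G \<Longrightarrow> conn G v v"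
  unfolding conn_def walk_def by (rule exI[of _ "[v]"]) auto

lemma walk_snoc:
  assumes "walk G u p x" "{x, y} \<in> edges G" "y \<in> vertices G"
  shows "walk G u (p @ [y]) y"
  using assms unfolding walk_def by (auto simp: successively_append_iff)

lemma conn_step: "conn G u x \<Longrightarrow> {x, y} \<in> edges G \<Longrightarrow> y \<in> vertices G \<Longrightarrow> conn G u y"
  unfolding conn_def using walk_snoc by metis

lemma walk_prefix:
  assumes "walk G u (p @ x # q) v"
  shows "walk G u (p @ [x]) x"
proof -
  have "successively (\<lambda>x y. {x, y} \<in> edges G) ((p @ [x]) @ q)" using assms by (simp add: walk_def)
  then have "successively (\<lambda>x y. {x, y} \<in> edges G) (p @ [x])"
    by (simp add: successively_append_iff)
  then show ?thesis using assms unfolding walk_def by (cases p) auto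
qed

lemma walk_induct [consumes 1, case_names start step]:
  assumes "walk G u p v" "P u"
    and "\<And>x y. P x \<Longrightarrow> x \<in> vertices G \<Longrightarrow> y \<in> vertices G \<Longrightarrow> {x, y} \<in> edges G \<Longrightarrow> P y"
  shows "P v"
  using assms
proof (induction p arbitrary: v rule: rev_induct)
  case Nil
  then show ?case by (simp add: walk_def)
next
  case (snoc y q)
  show ?case
  proof (cases "q = []")
    case True
    with snoc.prems show ?thesis by (auto simp: walk_def)
  next
    case False
    then have "walk G u q (last q)" "{last q, y} \<in> edges G" "last q \<in> vertices G" "y \<in> vertices G" "v = y"
      using snoc.prems(1) by (auto simp: walk_def successively_append_iff)
    with snoc show ?thesis by metis
  qed
qed

lemma conn_induct [consumes 1, case_names start step]:
  assumes "conn G u v" "P u"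
    and "\<And>x y. conn G u x \<Longrightarrow> P x \<Longrightarrow> y \<in> vertices G \<Longrightarrow> {x, y} \<in> edges G \<Longrightarrow> P y"
  shows "P v"
proof -
  from assms(1) obtain p where p: "walk G u p v" by (auto simp: conn_def)
  have u: "conn G u u" using assms(1) conn_vertices conn_refl by metis
  from p have "conn G u v \<and> P v"
    by (induction rule: walk_induct) (use assms u conn_step in metis)+
  then show ?thesis by simp
qed

lemma conn_trans:
  assumes "conn G v w" "conn G u v"
  shows "conn G u w"
  using assms by (induction rule: conn_induct) (auto intro: conn_step)

lemma conn_sym:
  assumes "conn G u v"
  shows "conn G v u"
  using assms
proof (induction rule: conn_induct)
  case start
  then show ?case using assms conn_vertices conn_refl by metis
next
  case (step x y)
  then have "{y, x} \<in> edges G" "x \<in> vertices G" "y \<in> vertices G"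
    using conn_vertices[of G u x] by (auto simp: insert_commute)
  then have "conn G y x" using conn_step[OF conn_refl, of y G x] by blast
  then show ?case using step conn_trans by metis
qed

lemma conn_mono:
  assumes "conn G u v" "vertices G \<subseteq> vertices H" "edges G \<subseteq> edges H"
  shows "conn H u v"
  using assms(1)
proof (induction rule: conn_induct)
  case start
  show ?case using assms conn_vertices[of G u v] conn_refl[of u H] by blast
next
  case (step x y)
  then show ?case using assms conn_step[of H u x y] by blast
qed

lemma upath_mono:
  assumes "upath G u p v" "vertices G \<subseteq> vertices H" "edges G \<subseteq> edges H"
  shows "upath H u p v"
  using assms unfolding upath_def walk_def by (auto elim: successively_mono)

lemma upath_exists:
  assumes "conn G u v"
  shows "\<exists>p. upath G u p v"
  using assms
proof (induction rule: conn_induct)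
  case start
  have "upath G u [u] u" using assms conn_vertices by (fastforce simp: upath_def walk_def)
  then show ?case by blast
next
  case (step x y)
  then obtain p where p: "upath G u p x" by blast
  show ?case
  proof (cases "y \<in> set p")
    case True
    then obtain p1 p2 where "p = p1 @ y # p2" by (meson split_list)
    then have "upath G u (p1 @ [y]) y"
      using p walk_prefix by (auto simp: upath_def)
    then show ?thesis by blast
  next
    case False
    then have "upath G u (p @ [y]) y"
      using p step walk_snoc by (auto simp: upath_def)
    then show ?thesis by blast
  qed
qed

definition induced_subgraph :: "'v ugraph \<Rightarrow> 'v set \<Rightarrow> 'v ugraph" where
  "induced_subgraph G S = \<lparr>vertices = vertices G \<inter> S, edges = {e \<in> edges G. e \<subseteq> S}\<rparr>"

text \<open>Records that a walk never leaves its own vertex set. With \<open>conn_mono\<close> the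
  connection survives any deletion that misses the walk.\<close>

lemma walk_conn_induced:
  assumes "walk G u p v" "x \<in> set p"
  shows "conn (induced_subgraph G (set p)) u x"
proof -
  obtain p1 p2 where p: "p = p1 @ x # p2" using assms(2) by (meson split_list)
  have w: "walk G u (p1 @ [x]) x" using assms(1) p walk_prefix by metis
  have "successively (\<lambda>x y. {x, y} \<in> edges (induced_subgraph G (set p))) (p1 @ [x])"
    using w unfolding walk_def
    by (auto simp: induced_subgraph_def p intro: successively_mono)
  then have "walk (induced_subgraph G (set p)) u (p1 @ [x]) x"
    using w unfolding walk_def by (auto simp: induced_subgraph_def p)
  then show ?thesis by (auto simp: conn_def)
qed

section \<open>Bridges and unique paths in trees\<close>

lemma edge_distinct: "simple_graph G \<Longrightarrow> {u, v} \<in> edges G \<Longrightarrow> u \<noteq> v"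
  by (force simp: simple_graph_def)

lemma edge_vertices:
  "simple_graph G \<Longrightarrow> {u, v} \<in> edges G \<Longrightarrow> u \<in> vertices G \<and> v \<in> vertices G"
  by (force simp: simple_graph_def)

lemma edge_obtain:
  assumes "simple_graph G" "e \<in> edges G"
  obtains u v where "e = {u, v}" "u \<noteq> v"
  using assms by (auto simp: simple_graph_def card_2_iff)

lemma tree_edge:
  assumes "tree T" "{u, v} \<in> edges T"
  shows "u \<noteq> v" "u \<in> vertices T" "v \<in> vertices T"
  using assms edge_distinct edge_vertices by (fastforce simp: tree_def)+

text \<open>A path around the edge would close up to a cycle. It has at least three vertices: one
  vertex would force \<open>u = v\<close>, two would use the deleted edge.\<close>

lemma tree_bridge:
  assumes "tree T" "{u, v} \<in> edges T"
  shows "\<not> conn (delete_edge T {u, v}) u v"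
proof
  assume "conn (delete_edge T {u, v}) u v"
  then obtain p where p: "upath (delete_edge T {u, v}) u p v"
    using upath_exists by metis
  have uv: "u \<noteq> v" using assms tree_edge by metis
  have pT: "upath T u p v" using p by (rule upath_mono) (auto simp: delete_edge_def)
  have "3 \<le> length p"
  proof (rule ccontr)
    assume "\<not> 3 \<le> length p"
    then have "length p = 0 \<or> length p = 1 \<or> length p = 2" by linarith
    then show False
      using p uv by (auto simp: upath_def walk_def delete_edge_def length_Suc_conv numeral_2_eq_2)
  qed
  then have "ucycle T p"
    using pT assms(2) by (auto simp: ucycle_def upath_def walk_def insert_commute)
  then show False using assms(1) by (auto simp: tree_def)
qed

text \<open>Converse of \<open>tree_bridge\<close>, so that the Hasse diagram can be shown acyclic
  without looking at cycles: a cycle still joins the ends of its closing edge once that edge is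
  deleted.\<close>

lemma tree_if_bridges:
  assumes "simple_graph T" "connected_graph T"
    and bridge: "\<And>u v. {u, v} \<in> edges T \<Longrightarrow> \<not> conn (delete_edge T {u, v}) u v"
  shows "tree T"
proof -
  have False if c: "ucycle T p" for p
  proof -
    have len: "3 \<le> length p" and p: "walk T (hd p) p (last p)" "distinct p"
      and e: "{last p, hd p} \<in> edges T"
      using c by (auto simp: ucycle_def upath_def)
    \<comment> \<open>Consecutive positions are never first and last, as the length is at least 3;
      hence the path does not use the closing edge.\<close>
    have "{p ! i, p ! Suc i} \<noteq> {hd p, last p}" if i: "Suc i < length p" for i
    proof
      assume "{p ! i, p ! Suc i} = {hd p, last p}"
      moreover have "hd p = p ! 0" "last p = p ! (length p - 1)"
        using len by (metis hd_conv_nth last_conv_nth list.size(3) not_numeral_le_zero)+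
      ultimately have "p ! i = p ! 0 \<and> p ! Suc i = p ! (length p - 1)
          \<or> p ! i = p ! (length p - 1) \<and> p ! Suc i = p ! 0"
        by (auto simp: doubleton_eq_iff)
      then show False
        using nth_eq_iff_index_eq[OF p(2), of i 0] nth_eq_iff_index_eq[OF p(2), of "Suc i" 0]
          nth_eq_iff_index_eq[OF p(2), of "Suc i" "length p - 1"] i len by linarith
    qed
    then have "walk (delete_edge T {hd p, last p}) (hd p) p (last p)"
      using p(1) by (auto simp: walk_def delete_edge_def successively_conv_nth)
    then have "conn (delete_edge T {hd p, last p}) (hd p) (last p)"
      by (auto simp: conn_def)
    then show False using bridge[of "hd p" "last p"] e by (simp add: insert_commute)
  qed
  then show ?thesis using assms by (auto simp: tree_def)
qed

text \<open>If the second vertices \<open>x\<close> and \<open>y\<close> differ, the remaining paths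
  both lead to \<open>v\<close> without meeting \<open>u\<close>, so the route \<open>u\<close>,
  \<open>y\<close>, \<open>v\<close>, \<open>x\<close> bypasses the bridge
  \<open>{u, x}\<close>.\<close>

lemma upath_unique:
  assumes T: "tree T" and "upath T u p v" "upath T u q v"
  shows "p = q"
  using assms(2,3)
proof (induction p arbitrary: u q)
  case Nil
  then show ?case by (simp add: upath_def walk_def)
next
  case (Cons a p)
  have a: "a = u" using Cons.prems by (simp add: upath_def walk_def)
  obtain q' where q: "q = u # q'"
    using Cons.prems(2) by (cases q) (auto simp: upath_def walk_def)
  show ?case
  proof (cases "p = [] \<or> q' = []")
    case True
    then show ?thesis using Cons.prems
      by (auto simp: upath_def walk_def q a split: if_splits dest: last_in_set)
  next
    case False
    then obtain x p2 y q2 where xy: "p = x # p2" "q' = y # q2" by (meson neq_Nil_conv)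
    have pu: "upath T x p v" "u \<notin> set p" and ux: "{u, x} \<in> edges T"
      and qu: "upath T y q' v" "u \<notin> set q'" and uy: "{u, y} \<in> edges T"
      using Cons.prems by (auto simp: upath_def walk_def q a xy)
    have "x = y"
    proof (rule ccontr)
      assume ne: "x \<noteq> y"
      let ?G = "delete_edge T {u, x}"
      have avoid: "conn ?G z v" if "upath T z r v" "u \<notin> set r" for z r
      proof -
        have "v \<in> set r" using that by (auto simp: upath_def walk_def)
        then have "conn (induced_subgraph T (set r)) z v"
          using that walk_conn_induced by (auto simp: upath_def)
        then show ?thesis
          by (rule conn_mono) (use that in \<open>auto simp: induced_subgraph_def delete_edge_def\<close>)
      qed
      have V: "u \<in> vertices T" "y \<in> vertices T" using tree_edge[OF T uy] by auto
      have "conn ?G u y"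
        by (rule conn_step[of _ _ u])
          (use V uy ne in \<open>auto simp: delete_edge_def doubleton_eq_iff intro: conn_refl\<close>)
      with avoid[OF pu] avoid[OF qu] have "conn ?G u x" using conn_sym conn_trans by metis
      then show False using tree_bridge[OF T ux] by simp
    qed
    then have "p = q'" using Cons.IH pu qu by blast
    then show ?thesis by (simp add: a q)
  qed
qed

lemma the_path_eqI: "tree T \<Longrightarrow> upath T u p v \<Longrightarrow> the_path T u v = p"
  unfolding the_path_def using upath_unique by (metis (mono_tags, lifting) the_equality)

lemma tree_conn: "tree T \<Longrightarrow> u \<in> vertices T \<Longrightarrow> v \<in> vertices T \<Longrightarrow> conn T u v"
  by (simp add: tree_def connected_graph_def conn_def)

lemma upath_the_path:
  assumes "tree T" "u \<in> vertices T" "v \<in> vertices T"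
  shows "upath T u (the_path T u v) v"
  using assms tree_conn upath_exists the_path_eqI by metis

text \<open>Replaces paths by reachability. Given a separating edge, unique paths stay inside the
  two components of the deletion; given disjoint paths, an edge entering the first path from the
  side of \<open>c\<close> separates.\<close>

lemma leaf_D_iff_separating_edge:
  assumes T: "tree T" and V: "a \<in> vertices T" "b \<in> vertices T" "c \<in> vertices T" "d \<in> vertices T"
  shows "leaf_D T a b c d \<longleftrightarrow>
    (\<exists>e\<in>edges T. conn (delete_edge T e) a b \<and> conn (delete_edge T e) c d
      \<and> \<not> conn (delete_edge T e) a c)"
proof
  assume "\<exists>e\<in>edges T. conn (delete_edge T e) a b \<and> conn (delete_edge T e) c d
      \<and> \<not> conn (delete_edge T e) a c"
  then obtain e where e: "conn (delete_edge T e) a b" "conn (delete_edge T e) c d"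
    "\<not> conn (delete_edge T e) a c" by blast
  have along: "conn (delete_edge T e) s x"
    if st: "conn (delete_edge T e) s t" and x: "x \<in> set (the_path T s t)" for s t x
  proof -
    obtain p where p: "upath (delete_edge T e) s p t" using upath_exists[OF st] by blast
    then have "upath T s p t" by (rule upath_mono) (auto simp: delete_edge_def)
    then have "x \<in> set p" using x the_path_eqI[OF T] by metis
    then have "conn (induced_subgraph (delete_edge T e) (set p)) s x"
      using p walk_conn_induced by (auto simp: upath_def)
    then show ?thesis by (rule conn_mono) (auto simp: induced_subgraph_def)
  qed
  then show "leaf_D T a b c d"
    using e unfolding leaf_D_def by (meson conn_sym conn_trans disjoint_iff)
next
  assume D: "leaf_D T a b c d"
  define P Q where "P = set (the_path T a b)" and "Q = set (the_path T c d)"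
  have disj: "P \<inter> Q = {}" using D by (simp add: leaf_D_def P_def Q_def)
  have wP: "walk T a (the_path T a b) b" and wQ: "walk T c (the_path T c d) d"
    using upath_the_path[OF T] V by (auto simp: upath_def)
  have aP: "a \<in> P" "b \<in> P" and cQ: "c \<in> Q" "d \<in> Q"
    using wP wQ unfolding P_def Q_def walk_def by (metis hd_in_set last_in_set)+
  \<comment> \<open>The part reachable from \<open>c\<close> without touching \<open>P\<close>. It
    misses \<open>a\<close>, so some edge of the tree leaves it, and the outer end of that edge can
    only lie on \<open>P\<close>.\<close>
  let ?K = "\<lambda>z. conn (induced_subgraph T (- P)) c z"
  have Kc: "?K c" using V aP cQ disj by (intro conn_refl) (auto simp: induced_subgraph_def)
  have "\<exists>x y. {x, y} \<in> edges T \<and> ?K y \<and> \<not> ?K x \<and> x \<in> vertices T"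
  proof (rule ccontr)
    assume no: "\<not> ?thesis"
    have "?K a" using tree_conn[OF T V(3) V(1)]
    proof (induction rule: conn_induct)
      case start
      show ?case by (rule Kc)
    next
      case (step x y)
      then have "{y, x} \<in> edges T" by (simp add: insert_commute)
      then show ?case using no step by blast
    qed
    then show False using aP conn_vertices by (fastforce simp: induced_subgraph_def)
  qed
  then obtain x y where xy: "{x, y} \<in> edges T" "?K y" "\<not> ?K x" "x \<in> vertices T" by blast
  have y: "y \<notin> P" using xy conn_vertices by (fastforce simp: induced_subgraph_def)
  have x: "x \<in> P"
  proof (rule ccontr)
    assume "x \<notin> P"
    then have "?K x" using xy y
      by (intro conn_step[OF xy(2)]) (auto simp: induced_subgraph_def insert_commute)
    then show False using xy by simp
  qed
  let ?G = "delete_edge T {x, y}"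
  have Pa: "conn ?G a z" if "z \<in> P" for z
    by (rule conn_mono[OF walk_conn_induced[OF wP]])
      (use that y in \<open>auto simp: P_def delete_edge_def induced_subgraph_def\<close>)
  have Qc: "conn ?G c z" if "z \<in> Q" for z
    by (rule conn_mono[OF walk_conn_induced[OF wQ]])
      (use that x disj in \<open>auto simp: Q_def delete_edge_def induced_subgraph_def\<close>)
  have cy: "conn ?G c y"
    by (rule conn_mono[OF xy(2)]) (use x in \<open>auto simp: delete_edge_def induced_subgraph_def\<close>)
  have "\<not> conn ?G a c"
    using tree_bridge[OF T xy(1)] Pa[OF x] cy conn_sym conn_trans by metis
  then show "\<exists>e\<in>edges T. conn (delete_edge T e) a b \<and> conn (delete_edge T e) c d
      \<and> \<not> conn (delete_edge T e) a c"
    using xy Pa aP Qc cQ by blast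
qed

section \<open>Branches of a tree\<close>

text \<open>The side of \<open>w\<close> at the edge, as seen from \<open>v\<close>. The arguments
  are ordered, so that a branch belongs to a directed edge.\<close>

definition branch :: "'v ugraph \<Rightarrow> 'v \<Rightarrow> 'v \<Rightarrow> 'v set" where
  "branch T v w = {z. conn (delete_edge T {v, w}) w z}"

text \<open>Following a connection from \<open>w\<close> shows that every vertex stays joined to
  \<open>v\<close> or to \<open>w\<close> after the deletion, so a single branch decides
  everything.\<close>

lemma conn_delete_edge_iff:
  assumes T: "tree T" and e: "{v, w} \<in> edges T" and x: "x \<in> vertices T" "y \<in> vertices T"
  shows "conn (delete_edge T {v, w}) x y \<longleftrightarrow> (x \<in> branch T v w \<longleftrightarrow> y \<in> branch T v w)"
proof -
  let ?G = "delete_edge T {v, w}"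
  have V: "vertices ?G = vertices T" by (simp add: delete_edge_def)
  have two: "conn ?G w z \<or> conn ?G v z" if "z \<in> vertices T" for z
    using tree_conn[OF T tree_edge(3)[OF T e] that]
  proof (induction rule: conn_induct)
    case start
    then show ?case using tree_edge(3)[OF T e] V conn_refl by metis
  next
    case (step x y)
    show ?case
    proof (cases "{x, y} = {v, w}")
      case True
      then have "y = v \<or> y = w" by (auto simp: doubleton_eq_iff)
      then show ?thesis using step V conn_refl by metis
    next
      case False
      then have "{x, y} \<in> edges ?G" "y \<in> vertices ?G" using step by (auto simp: delete_edge_def)
      then show ?thesis using step conn_step by metis
    qed
  qed
  show ?thesis
    using two[OF x(1)] two[OF x(2)] unfolding branch_def mem_Collect_eq
    by (meson conn_sym conn_trans)
qed

lemma branch_subset: "tree T \<Longrightarrow> branch T v w \<subseteq> vertices T"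
  using conn_vertices by (fastforce simp: branch_def delete_edge_def)

lemma branch_self:
  assumes "tree T" "{v, w} \<in> edges T"
  shows "w \<in> branch T v w" "v \<notin> branch T v w"
proof -
  show "w \<in> branch T v w"
    using tree_edge[OF assms] by (auto simp: branch_def delete_edge_def intro: conn_refl)
  show "v \<notin> branch T v w"
    using tree_bridge[OF assms] conn_sym[of _ w v] by (auto simp: branch_def)
qed

lemma branch_opposite:
  assumes T: "tree T" and e: "{v, w} \<in> edges T"
  shows "branch T w v = vertices T - branch T v w"
proof -
  have "z \<in> branch T w v \<longleftrightarrow> z \<in> vertices T - branch T v w" for z
  proof (cases "z \<in> vertices T")
    case True
    then show ?thesis
      using conn_delete_edge_iff[OF T e tree_edge(2)[OF T e] True] branch_self(2)[OF T e]
      by (simp add: branch_def insert_commute)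
  next
    case False
    then show ?thesis using branch_subset[OF T] by blast
  qed
  then show ?thesis by blast
qed

text \<open>Within its branch a connection never meets \<open>v\<close>, so deleting the edge or
  deleting its end \<open>v\<close> leaves the same component at \<open>w\<close>. This lets one
  notion serve both kinds of deletion.\<close>

lemma branch_eq_component:
  assumes T: "tree T" and e: "{v, w} \<in> edges T"
  shows "branch T v w = {z. conn (delete_vertex T v) w z}"
proof (intro equalityI subsetI)
  fix z assume "z \<in> {z. conn (delete_vertex T v) w z}"
  then have "conn (delete_edge T {v, w}) w z"
    by (auto intro: conn_mono simp: delete_vertex_def delete_edge_def)
  then show "z \<in> branch T v w" by (simp add: branch_def)
next
  fix z assume "z \<in> branch T v w"
  then have "conn (delete_edge T {v, w}) w z" by (simp add: branch_def)
  then show "z \<in> {z. conn (delete_vertex T v) w z}" unfolding mem_Collect_eq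
  proof (induction rule: conn_induct)
    case start
    show ?case using tree_edge[OF T e] by (auto simp: delete_vertex_def intro: conn_refl)
  next
    case (step x y)
    have "x \<noteq> v" using step conn_vertices by (fastforce simp: delete_vertex_def)
    have "conn (delete_edge T {v, w}) w y" using step conn_step by metis
    then have "y \<noteq> v" using branch_self(2)[OF T e] by (auto simp: branch_def)
    show ?case
      by (rule conn_step[OF step.IH])
        (use step \<open>x \<noteq> v\<close> \<open>y \<noteq> v\<close> in \<open>auto simp: delete_vertex_def delete_edge_def\<close>)
  qed
qed

lemma branch_cover:
  assumes T: "tree T" and v: "v \<in> vertices T" and z: "z \<in> vertices T" "z \<noteq> v"
  shows "\<exists>w. {v, w} \<in> edges T \<and> z \<in> branch T v w"
proof -
  have "z = v \<or> (\<exists>w. {v, w} \<in> edges T \<and> conn (delete_vertex T v) w z)"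
    using tree_conn[OF T v z(1)]
  proof (induction rule: conn_induct)
    case start
    show ?case by simp
  next
    case (step x y)
    show ?case
    proof (cases "y = v \<or> x = v")
      case True
      have "conn (delete_vertex T v) y y" if "y \<noteq> v"
        using step that by (auto simp: delete_vertex_def intro: conn_refl)
      then show ?thesis using True step by auto
    next
      case False
      then obtain w where w: "{v, w} \<in> edges T" "conn (delete_vertex T v) w x" using step by blast
      have "conn (delete_vertex T v) w y"
        by (rule conn_step[OF w(2)]) (use step False in \<open>auto simp: delete_vertex_def\<close>)
      then show ?thesis using w by blast
    qed
  qed
  then show ?thesis using z branch_eq_component[OF T] by blast
qed

text \<open>A common vertex would join \<open>w\<close> to \<open>w'\<close> without
  \<open>v\<close>, and the edge from \<open>w'\<close> to \<open>v\<close> would complete a detour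
  around the bridge \<open>{v, w}\<close>.\<close>

lemma branch_disjoint:
  assumes T: "tree T" and e: "{v, w} \<in> edges T" "{v, w'} \<in> edges T" "w \<noteq> w'"
  shows "branch T v w \<inter> branch T v w' = {}"
proof (rule ccontr)
  assume "branch T v w \<inter> branch T v w' \<noteq> {}"
  then obtain z where "conn (delete_vertex T v) w z" "conn (delete_vertex T v) w' z"
    using branch_eq_component[OF T] e by blast
  then have "conn (delete_vertex T v) w w'" using conn_sym conn_trans by metis
  then have "conn (delete_edge T {v, w}) w w'"
    by (rule conn_mono) (auto simp: delete_vertex_def delete_edge_def)
  then have "conn (delete_edge T {v, w}) w v"
    by (rule conn_step)
      (use e tree_edge[OF T e(1)] in \<open>auto simp: delete_edge_def doubleton_eq_iff insert_commute\<close>)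
  then show False using branch_self(2)[OF T e(1)] by (simp add: branch_def)
qed

lemma components_delete_vertex:
  assumes T: "tree T" and v: "v \<in> vertices T"
  shows "components (delete_vertex T v) = branch T v ` {w. {v, w} \<in> edges T}"
proof (intro equalityI subsetI)
  fix C assume "C \<in> components (delete_vertex T v)"
  then obtain u where u: "u \<in> vertices T" "u \<noteq> v" "C = {z. conn (delete_vertex T v) u z}"
    by (auto simp: components_def conn_def delete_vertex_def)
  then obtain w where w: "{v, w} \<in> edges T" "u \<in> branch T v w" using branch_cover[OF T v] by blast
  have "conn (delete_vertex T v) w u" using w branch_eq_component[OF T w(1)] by auto
  then have "conn (delete_vertex T v) u z \<longleftrightarrow> conn (delete_vertex T v) w z" for z
    using conn_sym conn_trans by metis
  then have "C = branch T v w"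
    unfolding u(3) branch_eq_component[OF T w(1)] by blast
  then show "C \<in> branch T v ` {w. {v, w} \<in> edges T}" using w by blast
next
  fix C assume "C \<in> branch T v ` {w. {v, w} \<in> edges T}"
  then obtain w where w: "{v, w} \<in> edges T" "C = branch T v w" by blast
  then have "w \<in> vertices (delete_vertex T v)"
    using tree_edge[OF T w(1)] by (auto simp: delete_vertex_def)
  then show "C \<in> components (delete_vertex T v)"
    using w branch_eq_component[OF T w(1)] by (auto simp: components_def conn_def)
qed

lemma components_delete_edge:
  assumes T: "tree T" and e: "{v, w} \<in> edges T"
  shows "components (delete_edge T {v, w}) = {branch T v w, branch T w v}"
proof -
  let ?G = "delete_edge T {v, w}"
  have comp: "{z. conn ?G u z} = (if u \<in> branch T v w then branch T v w else branch T w v)"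
    if u: "u \<in> vertices T" for u
  proof -
    have "z \<in> {z. conn ?G u z} \<longleftrightarrow> z \<in> vertices T \<and> (u \<in> branch T v w \<longleftrightarrow> z \<in> branch T v w)" for z
      using conn_delete_edge_iff[OF T e u, of z] conn_vertices[of ?G u z]
      by (auto simp: delete_edge_def)
    then show ?thesis using branch_subset[OF T] branch_opposite[OF T e] by auto
  qed
  have "components ?G = (\<lambda>u. if u \<in> branch T v w then branch T v w else branch T w v) ` vertices T"
    unfolding components_def conn_def[symmetric] using comp
    by (intro image_cong) (auto simp: delete_edge_def)
  moreover have "w \<in> vertices T" "v \<in> vertices T" "w \<in> branch T v w" "v \<notin> branch T v w"
    using tree_edge[OF T e] branch_self[OF T e] by auto
  ultimately show ?thesis by auto
qed

text \<open>The two edges point at each other. A vertex behind \<open>w\<close> can be reached from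
  \<open>w\<close> without meeting \<open>y\<close>, hence it lies in the branch at \<open>y\<close>
  that contains \<open>w\<close>.\<close>

lemma facing_branches_cover:
  assumes T: "tree T" and e: "{w, w'} \<in> edges T" "{y, y'} \<in> edges T"
    and "y \<in> branch T w w'" "w \<in> branch T y y'"
  shows "vertices T \<subseteq> branch T w w' \<union> branch T y y'"
proof -
  have e': "{w', w} \<in> edges T" using e by (simp add: insert_commute)
  have "z \<in> branch T y y'" if "z \<in> branch T w' w" for z
  proof -
    have "conn (delete_edge T {w', w}) w z" using that by (simp add: branch_def)
    then have "conn (delete_vertex T y) w z"
    proof (induction rule: conn_induct)
      case start
      have "w \<noteq> y" using branch_self(2)[OF T e(1)] assms by blast
      then show ?case using tree_edge[OF T e(1)] by (auto simp: delete_vertex_def intro: conn_refl)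
    next
      case (step x z)
      have "conn (delete_edge T {w', w}) w z" using step conn_step by metis
      then have "z \<in> branch T w' w" by (simp add: branch_def)
      then have "z \<noteq> y" using assms(4) branch_opposite[OF T e(1)] by blast
      moreover have "x \<noteq> y" using step.IH conn_vertices by (fastforce simp: delete_vertex_def)
      ultimately show ?case
        by (intro conn_step[OF step.IH])
          (use step in \<open>auto simp: delete_vertex_def delete_edge_def\<close>)
    qed
    then show ?thesis
      using assms(5) conn_trans branch_eq_component[OF T e(2)] by fastforce
  qed
  then show ?thesis using branch_opposite[OF T e(1)] by blast
qed

section \<open>Degrees and leaves in branches\<close>

lemma degree_eq_card_neighbours:
  assumes "simple_graph G"
  shows "degree G v = card {w. {v, w} \<in> edges G}"
proof -
  have "bij_betw (\<lambda>w. {v, w}) {w. {v, w} \<in> edges G} {e \<in> edges G. v \<in> e}"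
  proof (rule bij_betw_imageI)
    show "inj_on (\<lambda>w. {v, w}) {w. {v, w} \<in> edges G}"
      by (auto simp: inj_on_def doubleton_eq_iff)
    have "e \<in> (\<lambda>w. {v, w}) ` {w. {v, w} \<in> edges G}" if e: "e \<in> edges G" "v \<in> e" for e
    proof -
      obtain x y where "e = {x, y}" using edge_obtain[OF assms e(1)] by blast
      then have "e = {v, x} \<or> e = {v, y}" using e(2) by auto
      then show ?thesis using e(1) by blast
    qed
    then show "(\<lambda>w. {v, w}) ` {w. {v, w} \<in> edges G} = {e \<in> edges G. v \<in> e}" by blast
  qed
  from bij_betw_same_card[OF this] show ?thesis by (simp add: degree_def)
qed

lemma finite_neighbours:
  assumes "tree T" "finite_graph T"
  shows "finite {w. {v, w} \<in> edges T}"
proof (rule finite_subset)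
  show "{w. {v, w} \<in> edges T} \<subseteq> vertices T" using tree_edge(3)[OF assms(1)] by blast
  show "finite (vertices T)" using assms(2) by (simp add: finite_graph_def)
qed

text \<open>Descent: if \<open>w\<close> is not a leaf, it has a neighbour \<open>u\<close> other
  than \<open>v\<close>, and the branch from \<open>w\<close> to \<open>u\<close> is strictly
  smaller because it omits \<open>w\<close>.\<close>

lemma branch_has_leaf:
  assumes T: "tree T" "finite_graph T" and e: "{v, w} \<in> edges T"
  shows "\<exists>z\<in>leaves T. z \<in> branch T v w"
  using e
proof (induction "card (branch T v w)" arbitrary: v w rule: less_induct)
  case less
  note e = less.prems
  show ?case
  proof (cases "w \<in> leaves T")
    case True
    then show ?thesis using branch_self[OF T(1) e] by blast
  next
    case False
    then have "1 < degree T w" using tree_edge[OF T(1) e] by (auto simp: leaves_def)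
    then have "1 < card {u. {w, u} \<in> edges T}"
      using degree_eq_card_neighbours T by (metis tree_def)
    then have "\<not> {u. {w, u} \<in> edges T} \<subseteq> {v}"
      by (metis One_nat_def card.empty card_mono finite.emptyI finite_insert card_insert_disjoint
          empty_iff linorder_not_less)
    then obtain u where u: "{w, u} \<in> edges T" "u \<noteq> v" by blast
    have e': "{w, v} \<in> edges T" using e by (simp add: insert_commute)
    have "branch T w u \<subseteq> branch T v w"
      using branch_disjoint[OF T(1) u(1) e' u(2)] branch_opposite[OF T(1) e] branch_subset[OF T(1)]
      by blast
    moreover have "w \<in> branch T v w" "w \<notin> branch T w u"
      using branch_self[OF T(1)] e u by blast+
    moreover have "finite (branch T v w)"
      using T branch_subset finite_subset by (metis finite_graph_def)
    ultimately have "card (branch T w u) < card (branch T v w)" by (intro psubset_card_mono) auto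
    then show ?thesis using less.hyps u \<open>branch T w u \<subseteq> branch T v w\<close> by blast
  qed
qed

section \<open>Cuts and splittings of D-sets\<close>

lemma D_setD:
  assumes "D_set \<Omega> D" "w \<in> \<Omega>" "x \<in> \<Omega>" "y \<in> \<Omega>" "z \<in> \<Omega>"
  shows D_swap: "D w x y z \<Longrightarrow> D x w y z"
    and D_flip: "D w x y z \<Longrightarrow> D y z w x"
    and D_excl: "D w x y z \<Longrightarrow> \<not> D w y x z"
    and D_move: "\<And>v. D w x y z \<Longrightarrow> v \<in> \<Omega> \<Longrightarrow> D v x y z \<or> D w x y v"
    and D_triv: "w \<noteq> y \<Longrightarrow> x \<noteq> y \<Longrightarrow> D w x y y"
  using assms unfolding D_set_def by meson+

definition D_cut :: "'a set \<Rightarrow> ('a \<Rightarrow> 'a \<Rightarrow> 'a \<Rightarrow> 'a \<Rightarrow> bool) \<Rightarrow> 'a set \<Rightarrow> bool" where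
  "D_cut \<Omega> D A \<longleftrightarrow> A \<subseteq> \<Omega> \<and> A \<noteq> {} \<and> A \<noteq> \<Omega> \<and>
     (\<forall>a\<in>A. \<forall>b\<in>A. \<forall>c\<in>\<Omega> - A. \<forall>d\<in>\<Omega> - A. D a b c d)"

lemma D_cutD:
  "D_cut \<Omega> D A \<Longrightarrow> a \<in> A \<Longrightarrow> b \<in> A \<Longrightarrow> c \<in> \<Omega> - A \<Longrightarrow> d \<in> \<Omega> - A \<Longrightarrow> D a b c d"
  by (simp add: D_cut_def)

lemma D_cut_subset: "D_cut \<Omega> D A \<Longrightarrow> A \<subseteq> \<Omega>"
  by (simp add: D_cut_def)

lemma D_cut_compl:
  assumes "D_set \<Omega> D" "D_cut \<Omega> D A"
  shows "D_cut \<Omega> D (\<Omega> - A)"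
proof -
  have "D c d a b" if "a \<in> A" "b \<in> A" "c \<in> \<Omega> - A" "d \<in> \<Omega> - A" for a b c d
    using assms that D_flip[OF assms(1), of a b c d] unfolding D_cut_def by blast
  then show ?thesis using assms(2) unfolding D_cut_def by blast
qed

text \<open>(D4) turned round by (D1). In the construction of the tree these cuts become the leaves
  other than \<open>r\<close>.\<close>

lemma D_cut_singleton:
  assumes "D_set \<Omega> D" "x \<in> \<Omega>" "\<Omega> \<noteq> {x}"
  shows "D_cut \<Omega> D {x}"
proof -
  have "D x x c d" if "c \<in> \<Omega> - {x}" "d \<in> \<Omega> - {x}" for c d
    using that assms D_flip[OF assms(1), of c d x x] D_triv[OF assms(1), of c d x] by blast
  then show ?thesis using assms unfolding D_cut_def by blast
qed

text \<open>The witness is \<open>{x. D a x c d}\<close>: in a tree, this is the branch through \<open>a\<close> hanging off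
  the path from \<open>c\<close> to \<open>d\<close>.\<close>

lemma D_imp_cut:
  assumes D: "D_set \<Omega> D" and V: "a \<in> \<Omega>" "b \<in> \<Omega>" "c \<in> \<Omega>" "d \<in> \<Omega>" and Dabcd: "D a b c d"
  obtains A where "D_cut \<Omega> D A" "a \<in> A" "b \<in> A" "c \<in> \<Omega> - A" "d \<in> \<Omega> - A"
proof
  define A where "A = {x \<in> \<Omega>. D a x c d}"
  note sw = D_swap[OF D] and fl = D_flip[OF D] and ex = D_excl[OF D] and mv = D_move[OF D]
  \<comment> \<open>With equal middle arguments (D2) refutes itself, so \<open>D\<close> fails
    whenever its two pairs share a point, up to the symmetries (D1).\<close>
  have ac: "a \<noteq> c" using ex[of b a a d] sw[of a b c d] V Dabcd by blast
  have ad: "a \<noteq> d"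
    using ex[of b a a c] sw[of a b c d] fl[of b a c d] sw[of c d b a] fl[of d c b a] V Dabcd by blast
  have "D c d a a" using D_triv[OF D, of c d a] V ac ad by simp
  then show "a \<in> A" using fl[of c d a a] V by (simp add: A_def)
  then have aA: "a \<in> A" .
  show "b \<in> A" using V Dabcd by (simp add: A_def)
  show cA: "c \<in> \<Omega> - A" using V ex[of a c c d] by (auto simp: A_def)
  show dA: "d \<in> \<Omega> - A"
  proof -
    have "\<not> D a d c d"
      using V ex[of a d d c] fl[of a d c d] sw[of c d a d] fl[of d c a d] by blast
    then show ?thesis using V by (simp add: A_def)
  qed
  \<comment> \<open>For fixed \<open>c\<close> and \<open>d\<close> the relation
    \<open>D x y c d\<close> in \<open>x\<close> and \<open>y\<close> is transitive, and
    \<open>A\<close> is the class of \<open>a\<close>. If it failed, (D3) would yield both D(px;cy)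
    and D(py;cx), which (D2) excludes.\<close>
  have trans: "D x y c d" if xy: "D p x c d" "D p y c d" "p \<in> \<Omega>" "x \<in> \<Omega>" "y \<in> \<Omega>" for p x y
  proof -
    have "D y x c d \<or> D p x c y" using mv[of p x c d y] xy V by blast
    moreover have "D x y c d \<or> D p y c x" using mv[of p y c d x] xy V by blast
    moreover have "\<not> (D p x c y \<and> D p y c x)"
    proof
      assume *: "D p x c y \<and> D p y c x"
      then have "\<not> D x c p y" using sw[of p x c y] ex[of x p c y] xy V by blast
      moreover have "D x c p y" using * fl[of p y c x] sw[of c x p y] xy V by blast
      ultimately show False by simp
    qed
    ultimately show ?thesis using sw[of y x c d] xy V by blast
  qed
  \<comment> \<open>(D3) lets \<open>u\<close> replace either \<open>x\<close> or \<open>d\<close>.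
    The first alternative would put \<open>u\<close> into the class \<open>A\<close>.\<close>
  have cu: "D x y c u" if "x \<in> A" "y \<in> A" "u \<in> \<Omega> - A" for x y u
  proof -
    have xyu: "x \<in> \<Omega>" "y \<in> \<Omega>" "u \<in> \<Omega>" "D a x c d" "D a y c d" "\<not> D a u c d"
      using that by (auto simp: A_def)
    have "D x y c d" using trans[of a x y] xyu V by blast
    then have "D u y c d \<or> D x y c u" using mv[of x y c d u] xyu V by blast
    moreover have "\<not> D u y c d"
    proof
      assume "D u y c d"
      then have "D y u c d" "D y a c d" using xyu V sw[of u y c d] sw[of a y c d] by blast+
      then show False using trans[of y a u] xyu V by blast
    qed
    ultimately show ?thesis by blast
  qed
  have "D x y u v" if "x \<in> A" "y \<in> A" "u \<in> \<Omega> - A" "v \<in> \<Omega> - A" for x y u v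
  proof (rule ccontr)
    assume n: "\<not> D x y u v"
    have xy: "x \<in> \<Omega>" "y \<in> \<Omega>" "u \<in> \<Omega>" "v \<in> \<Omega>" using that by (auto simp: A_def)
    have sw2: "D p q s r" if "D p q r s" "p \<in> \<Omega>" "q \<in> \<Omega>" "r \<in> \<Omega>" "s \<in> \<Omega>" for p q r s
      using that fl[of p q r s] sw[of r s p q] fl[of s r p q] by blast
    have "D x y u c" "D x y v c" using cu[of x y u] cu[of x y v] sw2[of x y c u] sw2[of x y c v] that xy V by blast+
    \<comment> \<open>If D(xy;uv) fails, (D3) moves the other outer point into the first pair in
      both relations. The results differ by exchanging \<open>u\<close> and \<open>v\<close>, which
      (D2) forbids.\<close>
    then have "D v y u c" "D u y v c"
      using mv[of x y u c v] mv[of x y v c u] n sw2[of x y v u] xy V by blast+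
    then show False
      using ex[of y v u c] sw[of v y u c] sw[of u y v c] xy V by blast
  qed
  moreover have "A \<subseteq> \<Omega>" by (auto simp: A_def)
  ultimately show "D_cut \<Omega> D A" unfolding D_cut_def using aA cA by blast
qed

text \<open>For crossing cuts pick \<open>c\<close> in the first only and \<open>d\<close> in the
  second only. The first cut gives D(ac;dr), the second D(ad;cr), against (D2).\<close>

lemma D_cut_laminar:
  assumes D: "D_set \<Omega> D" and "D_cut \<Omega> D A" "D_cut \<Omega> D B" "a \<in> A" "a \<in> B" "r \<in> \<Omega> - A" "r \<in> \<Omega> - B"
  shows "A \<subseteq> B \<or> B \<subseteq> A"
proof (rule ccontr)
  assume "\<not> ?thesis"
  then obtain c d where c: "c \<in> A" "c \<notin> B" and d: "d \<in> B" "d \<notin> A" by blast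
  have "D a c d r" "D a d c r" "a \<in> \<Omega>" "c \<in> \<Omega>" "d \<in> \<Omega>" "r \<in> \<Omega>"
    using assms c d unfolding D_cut_def by blast+
  then show False using D_excl[OF D, of a c d r] by blast
qed

text \<open>The members of \<open>F\<close> containing \<open>a\<close> and avoiding
  \<open>r\<close> form a finite chain. For each outside point \<open>c\<close>, the union of those
  missing \<open>c\<close> is one of them and contains \<open>A\<close>. Hence the smallest member
  containing \<open>A\<close> misses every outside point and equals \<open>A\<close>.\<close>

lemma D_cut_in_separating_family:
  assumes D: "D_set \<Omega> D" and fin: "finite \<Omega>"
    and F: "\<And>S. S \<in> F \<Longrightarrow> D_cut \<Omega> D S" and a: "a \<in> A" and r: "r \<in> \<Omega> - A" and A: "A \<subseteq> \<Omega>"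
    and sep: "\<And>b c. b \<in> A \<Longrightarrow> c \<in> \<Omega> - A \<Longrightarrow> \<exists>S\<in>F. a \<in> S \<and> b \<in> S \<and> c \<notin> S \<and> r \<notin> S"
  shows "A \<in> F"
proof -
  define F' where "F' = {S \<in> F. a \<in> S \<and> r \<notin> S}"
  have "F' \<subseteq> Pow \<Omega>" using D_cut_subset[OF F] by (auto simp: F'_def)
  then have finF: "finite F'" using fin finite_Pow_iff finite_subset by metis
  have chain: "subset.chain UNIV G" if "G \<subseteq> F'" for G
    unfolding subset_chain_def
  proof (intro conjI ballI subset_UNIV)
    fix S S' assume "S \<in> G" "S' \<in> G"
    then have "S \<in> F'" "S' \<in> F'" using that by auto
    then show "S \<subseteq> S' \<or> S' \<subseteq> S"
      using D_cut_laminar[OF D F F, of S S' a r] r by (auto simp: F'_def)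
  qed
  have sepA: "\<exists>S\<in>F'. A \<subseteq> S \<and> c \<notin> S" if c: "c \<in> \<Omega> - A" for c
  proof -
    let ?G = "{S \<in> F'. c \<notin> S}"
    have "?G \<noteq> {}" using sep[OF a c] by (auto simp: F'_def)
    moreover have "finite ?G" using finF by simp
    moreover have "subset.chain UNIV ?G" by (rule chain) auto
    ultimately have "\<Union>?G \<in> ?G" by (metis (no_types, lifting) Union_in_chain)
    moreover have "A \<subseteq> \<Union>?G" using sep[OF _ c] by (auto simp: F'_def)
    ultimately show ?thesis by blast
  qed
  let ?H = "{S \<in> F'. A \<subseteq> S}"
  have "?H \<noteq> {}" using sepA[OF r] by auto
  moreover have "finite ?H" using finF by simp
  moreover have "subset.chain UNIV ?H" by (rule chain) auto
  ultimately have H: "\<Inter>?H \<in> ?H" by (metis (no_types, lifting) Inter_in_chain)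
  have "\<Inter>?H \<subseteq> A"
  proof
    fix c assume c: "c \<in> \<Inter>?H"
    then have "c \<in> \<Omega>" using H D_cut_subset[OF F] by (auto simp: F'_def)
    then show "c \<in> A" using c sepA[of c] by blast
  qed
  then have "\<Inter>?H = A" by blast
  then show ?thesis using H by (auto simp: F'_def)
qed

section \<open>Splittings and their sectors\<close>

lemma splittingD:
  assumes "splitting \<Omega> D P"
  shows splitting_partition: "partition_on \<Omega> P"
    and splitting_not_D: "\<And>A B C E a b c d. distinct [A, B, C, E] \<Longrightarrow> A \<in> P \<Longrightarrow> B \<in> P \<Longrightarrow> C \<in> P \<Longrightarrow>
      E \<in> P \<Longrightarrow> a \<in> A \<Longrightarrow> b \<in> B \<Longrightarrow> c \<in> C \<Longrightarrow> d \<in> E \<Longrightarrow> \<not> D a b c d"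
  using assms unfolding splitting_def by meson+

lemma splitting_sector_cut:
  assumes "splitting \<Omega> D P" "S \<in> P"
  shows "D_cut \<Omega> D S"
proof -
  have p: "partition_on \<Omega> P" using assms by (simp add: splitting_def)
  obtain S' where S': "S' \<in> P" "S' \<noteq> S" using assms(1) unfolding splitting_def by metis
  have "S' \<inter> S = {}" using partition_onD2[OF p] S' assms(2) by (auto simp: disjoint_def)
  moreover have "S' \<noteq> {}" "S \<noteq> {}" "S' \<subseteq> \<Omega>" "S \<subseteq> \<Omega>"
    using partition_onD1[OF p] partition_onD3[OF p] S' assms by auto
  moreover have "\<forall>a\<in>S. \<forall>b\<in>S. \<forall>c\<in>\<Omega> - S. \<forall>d\<in>\<Omega> - S. D a b c d"
    using assms unfolding splitting_def by meson
  ultimately show ?thesis unfolding D_cut_def by blast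
qed

text \<open>With only two parts condition (ii) is vacuous, and condition (i) says that both parts
  are cuts.\<close>

lemma splitting_two_iff:
  assumes D: "D_set \<Omega> D"
  shows "splitting \<Omega> D P \<and> card P = 2 \<longleftrightarrow> (\<exists>A. D_cut \<Omega> D A \<and> P = {A, \<Omega> - A})"
proof
  assume P: "splitting \<Omega> D P \<and> card P = 2"
  then obtain A B where AB: "P = {A, B}" "A \<noteq> B" by (auto simp: card_2_iff)
  have p: "partition_on \<Omega> P" using P by (simp add: splitting_def)
  have "B = \<Omega> - A"
    using partition_onD1[OF p] partition_onD2[OF p] AB by (auto simp: disjoint_def)
  then show "\<exists>A. D_cut \<Omega> D A \<and> P = {A, \<Omega> - A}" using splitting_sector_cut P AB by blast
next
  assume "\<exists>A. D_cut \<Omega> D A \<and> P = {A, \<Omega> - A}"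
  then obtain A where A: "D_cut \<Omega> D A" and P: "P = {A, \<Omega> - A}" by blast
  have ne: "A \<noteq> \<Omega> - A" "A \<noteq> {}" "\<Omega> - A \<noteq> {}" "A \<subseteq> \<Omega>" using A by (auto simp: D_cut_def)
  have "partition_on \<Omega> P" using ne P by (auto simp: partition_on_def disjoint_def)
  moreover have "card P = 2" using ne P by simp
  moreover have "\<forall>S\<in>P. D_cut \<Omega> D S" using A P D_cut_compl[OF D A] by blast
  then have "\<forall>S\<in>P. \<forall>a\<in>S. \<forall>b\<in>S. \<forall>c\<in>\<Omega> - S. \<forall>d\<in>\<Omega> - S. D a b c d"
    by (simp add: D_cut_def)
  moreover have "\<not> distinct [W, X, Y, Z]" if "W \<in> P" "X \<in> P" "Y \<in> P" "Z \<in> P" for W X Y Z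
    using that P by auto
  moreover have "\<exists>A\<in>P. \<exists>B\<in>P. A \<noteq> B" using P ne(1) by (meson insertI1 insertI2)
  ultimately show "splitting \<Omega> D P \<and> card P = 2"
    unfolding splitting_def by meson
qed

text \<open>A point \<open>r\<close> of \<open>S\<close> lies outside all other sectors, so
  intersecting ones are nested. If \<open>C'\<close> is not inside \<open>C\<close>, it contains
  \<open>C\<close> and a further sector \<open>E\<close> of \<open>P\<close>. A third sector of
  \<open>Q\<close> supplies a point \<open>y\<close> outside \<open>C'\<close> and \<open>S\<close>,
  lying in yet another sector \<open>G\<close> of \<open>P\<close>. The cut \<open>C'\<close> then
  gives D(cx;yr) across the four distinct parts \<open>C\<close>, \<open>E\<close>,
  \<open>G\<close>, \<open>S\<close>, against condition (ii).\<close>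

lemma splitting_refine_common_sector:
  assumes D: "D_set \<Omega> D" and P: "splitting \<Omega> D P" and Q: "splitting \<Omega> D Q" "3 \<le> card Q"
    and S: "S \<in> P" "S \<in> Q" and C: "C \<in> P" "C \<noteq> S" and C': "C' \<in> Q" "C' \<noteq> S" and "C \<inter> C' \<noteq> {}"
  shows "C' \<subseteq> C"
proof (rule ccontr)
  assume n: "\<not> C' \<subseteq> C"
  have pP: "partition_on \<Omega> P" and pQ: "partition_on \<Omega> Q" using P Q by (auto simp: splitting_def)
  have disjP: "X = Y" if "X \<in> P" "Y \<in> P" "z \<in> X" "z \<in> Y" for X Y z
    using that partition_onD2[OF pP] by (auto simp: disjoint_def)
  have disjQ: "X = Y" if "X \<in> Q" "Y \<in> Q" "z \<in> X" "z \<in> Y" for X Y z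
    using that partition_onD2[OF pQ] by (auto simp: disjoint_def)
  have sub: "X \<subseteq> \<Omega>" "X \<noteq> {}" if "X \<in> P \<or> X \<in> Q" for X
    using that partition_onD1[OF pP] partition_onD3[OF pP] partition_onD1[OF pQ] partition_onD3[OF pQ]
    by auto
  obtain r where r: "r \<in> S" using sub(2) S by blast
  then have r\<Omega>: "r \<in> \<Omega>" using sub(1) S by blast
  have rX: "r \<notin> X" if "X \<in> P \<and> X \<noteq> S \<or> X \<in> Q \<and> X \<noteq> S" for X
    using that disjP disjQ r S by blast
  have lam: "X \<subseteq> C' \<or> C' \<subseteq> X" if "X \<in> P" "X \<noteq> S" "z \<in> X" "z \<in> C'" for X z
    using D_cut_laminar[OF D splitting_sector_cut[OF P] splitting_sector_cut[OF Q(1)], of X C' z r]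
      that C' rX r\<Omega> by blast
  obtain c where c: "c \<in> C" "c \<in> C'" using \<open>C \<inter> C' \<noteq> {}\<close> by blast
  have CC': "C \<subseteq> C'" using lam C c n by blast
  obtain x where x: "x \<in> C'" "x \<notin> C" using n by blast
  then have "x \<in> \<Omega>" using sub(1) C' by blast
  then obtain E where E: "E \<in> P" "x \<in> E" using partition_onD1[OF pP] by blast
  have ES: "E \<noteq> S" using E x C' S disjQ by blast
  have EC': "E \<subseteq> C'" using lam[OF E(1) ES E(2) x(1)] disjP[OF C(1) E(1) c(1)] c x E(2) by blast
  obtain F where F: "F \<in> Q" "F \<noteq> C'" "F \<noteq> S"
  proof (rule ccontr)
    assume "\<not> thesis"
    then have "Q \<subseteq> {C', S}" using that by blast
    then have "card Q \<le> card {C', S}" by (rule card_mono[rotated]) simp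
    also have "\<dots> \<le> 2" by (simp add: card_insert_if)
    finally show False using Q(2) by simp
  qed
  obtain y where y: "y \<in> F" using sub(2) F by blast
  then have "y \<in> \<Omega>" using sub(1) F by blast
  then obtain G where G: "G \<in> P" "y \<in> G" using partition_onD1[OF pP] by blast
  have yC': "y \<notin> C'" using disjQ F y C' by blast
  have "G \<noteq> S" using disjQ F y S G by blast
  moreover have "G \<noteq> C" "G \<noteq> E" using G yC' CC' EC' by auto
  moreover have "E \<noteq> C" using E x by auto
  ultimately have "distinct [C, E, G, S]" using C ES by auto
  then have "\<not> D c x y r"
    using splitting_not_D[OF P] C(1) E(1) G(1) S(1) c(1) E(2) G(2) r by metis
  moreover have "D_cut \<Omega> D C'" using splitting_sector_cut Q C' by blast
  then have "D c x y r" using c x yC' \<open>y \<in> \<Omega>\<close> r\<Omega> rX C' by (intro D_cutD[of \<Omega> D C']) auto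
  ultimately show False by simp
qed

lemma splitting_eq_if_common_sector:
  assumes D: "D_set \<Omega> D" and P: "splitting \<Omega> D P" "3 \<le> card P"
    and Q: "splitting \<Omega> D Q" "3 \<le> card Q" and S: "S \<in> P" "S \<in> Q"
  shows "P = Q"
proof -
  have "P \<subseteq> Q" if P: "splitting \<Omega> D P" "3 \<le> card P" and Q: "splitting \<Omega> D Q" "3 \<le> card Q"
    and S: "S \<in> P" "S \<in> Q" for P Q
  proof
    fix C assume C: "C \<in> P"
    show "C \<in> Q"
    proof (cases "C = S")
      case True
      then show ?thesis using S by simp
    next
      case False
      have pP: "partition_on \<Omega> P" and pQ: "partition_on \<Omega> Q" using P Q by (auto simp: splitting_def)
      obtain c where c: "c \<in> C" "c \<in> \<Omega>"
        using C partition_onD1[OF pP] partition_onD3[OF pP] by (metis UnionI ex_in_conv)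
      then obtain C' where C': "C' \<in> Q" "c \<in> C'" using partition_onD1[OF pQ] by blast
      have "C' \<noteq> S" using C c C' S False partition_onD2[OF pP] by (auto simp: disjoint_def)
      then have "C' \<subseteq> C" "C \<subseteq> C'"
        using splitting_refine_common_sector[OF D P(1) Q S C False C'(1)]
          splitting_refine_common_sector[OF D Q(1) P S(2,1) C'(1) _ C False] c C' by blast+
      then show ?thesis using C' by auto
    qed
  qed
  from this[OF P Q S] this[OF Q P S(2,1)] show ?thesis by blast
qed

section \<open>D-sets represented by trees\<close>

locale represented_D_set =
  fixes \<Omega> :: "'a set" and D and T :: "'v ugraph" and f
  assumes finite_\<Omega>: "finite \<Omega>" and D: "D_set \<Omega> D" and rep: "represents \<Omega> D T f"
begin

lemma tree: "tree T" and finite_T: "finite_graph T"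
  and no_degree_2: "v \<in> vertices T \<Longrightarrow> degree T v \<noteq> 2"
  and bij_leaves: "bij_betw f \<Omega> (leaves T)"
  and D_iff_leaf_D: "a \<in> \<Omega> \<Longrightarrow> b \<in> \<Omega> \<Longrightarrow> c \<in> \<Omega> \<Longrightarrow> d \<in> \<Omega> \<Longrightarrow> D a b c d \<longleftrightarrow> leaf_D T (f a) (f b) (f c) (f d)"
  using rep by (auto simp: represents_def D_isomorphism_def)

lemma f_leaf: "x \<in> \<Omega> \<Longrightarrow> f x \<in> leaves T"
  using bij_leaves by (meson bij_betwE)

lemma f_vertex: "x \<in> \<Omega> \<Longrightarrow> f x \<in> vertices T"
  using f_leaf by (auto simp: leaves_def)

lemma leaf_obtain:
  assumes "v \<in> leaves T"
  obtains x where "x \<in> \<Omega>" "v = f x"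
  using assms bij_leaves by (auto simp: bij_betw_def)

definition sector :: "'v \<Rightarrow> 'v \<Rightarrow> 'a set" where
  "sector v w = {x \<in> \<Omega>. f x \<in> branch T v w}"

lemma sector_subset: "sector v w \<subseteq> \<Omega>"
  by (auto simp: sector_def)

lemma sector_nonempty:
  assumes "{v, w} \<in> edges T"
  shows "sector v w \<noteq> {}"
proof -
  obtain z where z: "z \<in> leaves T" "z \<in> branch T v w"
    using branch_has_leaf[OF tree finite_T assms] by blast
  obtain x where "x \<in> \<Omega>" "z = f x" using z(1) by (rule leaf_obtain)
  then show ?thesis using z by (auto simp: sector_def)
qed

lemma sector_opposite:
  assumes "{v, w} \<in> edges T"
  shows "sector w v = \<Omega> - sector v w"
  using branch_opposite[OF tree assms] f_vertex by (auto simp: sector_def)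

lemma sector_disjoint:
  assumes "{v, w} \<in> edges T" "{v, w'} \<in> edges T" "w \<noteq> w'"
  shows "sector v w \<inter> sector v w' = {}"
  using branch_disjoint[OF tree assms] by (auto simp: sector_def)

lemma sector_cover:
  assumes "v \<in> vertices T" "x \<in> \<Omega>" "f x \<noteq> v"
  shows "\<exists>w. {v, w} \<in> edges T \<and> x \<in> sector v w"
  using branch_cover[OF tree assms(1) f_vertex[OF assms(2)] assms(3)] assms(2)
  by (auto simp: sector_def)

text \<open>The separating edge can be directed towards \<open>a\<close>, so one sector expresses
  the separation. The sectors thus witness every instance of \<open>D\<close>.\<close>

lemma D_iff_sector:
  assumes "a \<in> \<Omega>" "b \<in> \<Omega>" "c \<in> \<Omega>" "d \<in> \<Omega>"
  shows "D a b c d \<longleftrightarrow>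
    (\<exists>v w. {v, w} \<in> edges T \<and> a \<in> sector v w \<and> b \<in> sector v w \<and> c \<notin> sector v w \<and> d \<notin> sector v w)"
    (is "_ \<longleftrightarrow> ?R")
proof
  assume "D a b c d"
  then have "leaf_D T (f a) (f b) (f c) (f d)" using D_iff_leaf_D assms by simp
  then obtain e where e: "e \<in> edges T" "conn (delete_edge T e) (f a) (f b)"
    "conn (delete_edge T e) (f c) (f d)" "\<not> conn (delete_edge T e) (f a) (f c)"
    using leaf_D_iff_separating_edge[OF tree] f_vertex assms by metis
  obtain v w where vw: "e = {v, w}" using edge_obtain e(1) tree by (metis tree_def)
  have E: "{v, w} \<in> edges T" "{w, v} \<in> edges T" using e(1) vw by (auto simp: insert_commute)
  note iff = conn_delete_edge_iff[OF tree E(1) f_vertex f_vertex]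
  have mem: "x \<in> sector v w \<longleftrightarrow> f x \<in> branch T v w" if "x \<in> \<Omega>" for x
    using that by (simp add: sector_def)
  have "(a \<in> sector v w \<longleftrightarrow> b \<in> sector v w) \<and> (c \<in> sector v w \<longleftrightarrow> d \<in> sector v w)
      \<and> \<not> (a \<in> sector v w \<longleftrightarrow> c \<in> sector v w)"
    using e(2-4) iff assms mem unfolding vw by simp
  moreover have "x \<in> sector w v \<longleftrightarrow> x \<notin> sector v w" if "x \<in> \<Omega>" for x
    using that sector_opposite[OF E(1)] by blast
  ultimately show ?R using E assms by metis
next
  assume ?R
  then obtain v w where vw: "{v, w} \<in> edges T" "a \<in> sector v w" "b \<in> sector v w"
    "c \<notin> sector v w" "d \<notin> sector v w" by blast
  then have "conn (delete_edge T {v, w}) (f a) (f b)" "conn (delete_edge T {v, w}) (f c) (f d)"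
    "\<not> conn (delete_edge T {v, w}) (f a) (f c)"
    using assms f_vertex conn_delete_edge_iff[OF tree vw(1)] by (auto simp: sector_def)
  then have "leaf_D T (f a) (f b) (f c) (f d)"
    using leaf_D_iff_separating_edge[OF tree] f_vertex assms vw(1) by blast
  then show "D a b c d" using D_iff_leaf_D assms by simp
qed

lemma sector_cut:
  assumes e: "{v, w} \<in> edges T"
  shows "D_cut \<Omega> D (sector v w)"
proof -
  have "{w, v} \<in> edges T" using e by (simp add: insert_commute)
  then have "sector v w \<noteq> \<Omega>" using sector_nonempty sector_opposite[OF e] by blast
  moreover have "D a b c d" if "a \<in> sector v w" "b \<in> sector v w" "c \<in> \<Omega> - sector v w" "d \<in> \<Omega> - sector v w"
    for a b c d
    using that sector_subset e D_iff_sector[of a b c d] by blast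
  ultimately show ?thesis
    using sector_subset sector_nonempty[OF e] unfolding D_cut_def by simp
qed

text \<open>A cut yields D(ab;cr) for each \<open>b\<close> inside and \<open>c\<close> outside, and
  the tree explains each such instance by a sector. So the sectors form a separating family for the
  cut.\<close>

lemma D_cut_is_sector:
  assumes A: "D_cut \<Omega> D A"
  shows "\<exists>v w. {v, w} \<in> edges T \<and> A = sector v w"
proof -
  let ?F = "{sector v w |v w. {v, w} \<in> edges T}"
  obtain a r where a: "a \<in> A" and r: "r \<in> \<Omega> - A" using A by (auto simp: D_cut_def)
  have "A \<in> ?F"
  proof (rule D_cut_in_separating_family[OF D finite_\<Omega> _ a r D_cut_subset[OF A]])
    show "D_cut \<Omega> D S" if "S \<in> ?F" for S using that sector_cut by blast
    show "\<exists>S\<in>?F. a \<in> S \<and> b \<in> S \<and> c \<notin> S \<and> r \<notin> S" if "b \<in> A" "c \<in> \<Omega> - A" for b c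
    proof -
      have "D a b c r" using D_cutD[OF A] a r that by blast
      then show ?thesis
        using D_iff_sector[of a b c r] a r that D_cut_subset[OF A] by blast
    qed
  qed
  then show ?thesis by blast
qed

section \<open>Directed edges are determined by their cuts\<close>

lemma third_neighbour:
  assumes "{v, w} \<in> edges T" "{v, w'} \<in> edges T" "w \<noteq> w'"
  shows "\<exists>u. {v, u} \<in> edges T \<and> u \<noteq> w \<and> u \<noteq> w'"
proof (rule ccontr)
  assume "\<not> ?thesis"
  then have "{u. {v, u} \<in> edges T} = {w, w'}" using assms by blast
  then have "degree T v = 2"
    using degree_eq_card_neighbours[of T v] tree assms(3) by (simp add: tree_def)
  then show False using no_degree_2 tree_edge(2)[OF tree assms(1)] by blast
qed

text \<open>The case in which the way from \<open>w\<close> to the other head \<open>y\<close>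
  starts back over \<open>v\<close>; the common sector then lies in \<open>sector y y'\<close>. If
  \<open>y'\<close> is \<open>x\<close>, it would lie in its own complement. Otherwise
  \<open>y\<close> has a third neighbour \<open>z\<close>, and the leaves in the direction of
  \<open>z\<close> would lie in two disjoint sectors.\<close>

lemma sector_inject_aux:
  assumes e: "{v, w} \<in> edges T" "{x, y} \<in> edges T" and eq: "sector v w = sector x y"
    and y': "{y, y'} \<in> edges T" and cover: "\<Omega> \<subseteq> sector w v \<union> sector y y'"
  shows False
proof -
  have e': "{w, v} \<in> edges T" "{y, x} \<in> edges T" using e by (auto simp: insert_commute)
  have sub: "sector v w \<subseteq> sector y y'"
    using cover sector_opposite[OF e(1)] sector_subset by blast
  show False
  proof (cases "x = y'")
    case True
    then show ?thesis
      using sub eq sector_opposite[OF e(2)] sector_nonempty[OF e(1)] by blast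
  next
    case False
    then obtain z where z: "{y, z} \<in> edges T" "z \<noteq> x" "z \<noteq> y'"
      using third_neighbour[OF e'(2) y'] by blast
    have "sector y z \<inter> sector y x = {}" "sector y z \<inter> sector y y' = {}"
      using sector_disjoint z e' y' by blast+
    then show ?thesis
      using sub eq sector_opposite[OF e(2)] sector_nonempty[OF z(1)] sector_subset by blast
  qed
qed

text \<open>If the heads \<open>w\<close> and \<open>y\<close> differ, the sectors by which they
  look at each other cover everything. Either one look goes back along its own edge, or the common
  complement \<open>sector w v = sector y x\<close> is disjoint from both. Once the heads agree, the
  tails do because sectors at one vertex are disjoint.\<close>

lemma sector_inject:
  assumes e: "{v, w} \<in> edges T" "{x, y} \<in> edges T" and eq: "sector v w = sector x y"
  shows "v = x \<and> w = y"
proof -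
  have e': "{w, v} \<in> edges T" "{y, x} \<in> edges T" using e by (auto simp: insert_commute)
  have opp: "sector w v = sector y x" using sector_opposite[OF e(1)] sector_opposite[OF e(2)] eq by simp
  have V: "w \<in> vertices T" "y \<in> vertices T" using tree_edge(3)[OF tree] e by blast+
  have wy: "w = y"
  proof (rule ccontr)
    assume ne: "w \<noteq> y"
    obtain w' where w': "{w, w'} \<in> edges T" "y \<in> branch T w w'"
      using branch_cover[OF tree V(1) V(2)] ne by blast
    obtain y' where y': "{y, y'} \<in> edges T" "w \<in> branch T y y'"
      using branch_cover[OF tree V(2) V(1)] ne by blast
    have cover: "\<Omega> \<subseteq> sector w w' \<union> sector y y'"
      using facing_branches_cover[OF tree w'(1) y'(1) w'(2) y'(2)] f_vertex by (auto simp: sector_def)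
    consider "v = w'" | "x = y'" | "v \<noteq> w'" "x \<noteq> y'" by blast
    then show False
    proof cases
      case 1
      then show ?thesis using sector_inject_aux[OF e eq y'(1)] cover by blast
    next
      case 2
      then show ?thesis using sector_inject_aux[OF e(2,1) eq[symmetric] w'(1)] cover by blast
    next
      case 3
      then have "sector w v \<inter> sector w w' = {}" "sector y x \<inter> sector y y' = {}"
        using sector_disjoint e' w'(1) y'(1) by blast+
      then show ?thesis using opp cover sector_nonempty[OF e'(1)] sector_subset by blast
    qed
  qed
  moreover have "v = x"
    using sector_disjoint[of w v x] e' wy opp sector_nonempty[OF e'(1)] by blast
  ultimately show ?thesis by simp
qed

section \<open>Partitions at vertices and edges\<close>

definition vertex_partition :: "'v \<Rightarrow> 'a set set" where
  "vertex_partition v = sector v ` {w. {v, w} \<in> edges T}"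

lemma induced_partition_delete_vertex:
  assumes "v \<in> vertices T"
  shows "induced_partition \<Omega> f (delete_vertex T v) = vertex_partition v"
  unfolding induced_partition_def vertex_partition_def components_delete_vertex[OF tree assms]
  by (simp add: image_image sector_def)

lemma induced_partition_delete_edge:
  assumes "{v, w} \<in> edges T"
  shows "induced_partition \<Omega> f (delete_edge T {v, w}) = {sector v w, sector w v}"
  unfolding induced_partition_def components_delete_edge[OF tree assms]
  by (simp add: sector_def)

lemma card_vertex_partition: "card (vertex_partition v) = degree T v"
proof -
  have "inj_on (sector v) {w. {v, w} \<in> edges T}" using sector_inject by (auto intro: inj_onI)
  then show ?thesis
    using degree_eq_card_neighbours[of T v] tree
    by (simp add: vertex_partition_def card_image tree_def)
qed

text \<open>A path avoiding \<open>v\<close> would stay within one branch at \<open>v\<close>. This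
  is the source of condition (ii): two paths through \<open>v\<close> cannot be disjoint.\<close>

lemma vertex_on_path:
  assumes e: "{v, w} \<in> edges T" "{v, w'} \<in> edges T" "w \<noteq> w'" and a: "a \<in> sector v w" and b: "b \<in> sector v w'"
  shows "v \<in> set (the_path T (f a) (f b))"
proof (rule ccontr)
  let ?p = "the_path T (f a) (f b)"
  assume v: "v \<notin> set ?p"
  have V: "f a \<in> vertices T" "f b \<in> vertices T" using a b f_vertex sector_subset by blast+
  have w: "walk T (f a) ?p (f b)" using upath_the_path[OF tree V] by (simp add: upath_def)
  then have "f b \<in> set ?p" unfolding walk_def by (metis last_in_set)
  from walk_conn_induced[OF w this] have "conn (delete_vertex T v) (f a) (f b)"
    by (rule conn_mono) (use v in \<open>auto simp: induced_subgraph_def delete_vertex_def\<close>)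
  moreover have "conn (delete_vertex T v) w (f a)"
    using a branch_eq_component[OF tree e(1)] by (auto simp: sector_def)
  ultimately have "conn (delete_vertex T v) w (f b)" using conn_trans by metis
  then have "f b \<in> branch T v w" using branch_eq_component[OF tree e(1)] by auto
  then show False using b branch_disjoint[OF tree e] by (auto simp: sector_def)
qed

lemma inner_vertex_degree: "v \<in> inner_vertices T \<Longrightarrow> 3 \<le> degree T v"
  using no_degree_2[of v] by (auto simp: inner_vertices_def leaves_def)

lemma splitting_vertex_partition:
  assumes v: "v \<in> inner_vertices T"
  shows "splitting \<Omega> D (vertex_partition v)"
proof -
  let ?P = "vertex_partition v"
  have vV: "v \<in> vertices T" "v \<notin> leaves T" using v by (auto simp: inner_vertices_def)
  have memE: "\<exists>w. {v, w} \<in> edges T \<and> A = sector v w" if "A \<in> ?P" for A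
    using that by (auto simp: vertex_partition_def)
  have "partition_on \<Omega> ?P"
  proof (rule partition_onI)
    show "{} \<notin> ?P" using memE sector_nonempty by blast
    show "disjnt A B" if "A \<in> ?P" "B \<in> ?P" "A \<noteq> B" for A B
      using memE[OF that(1)] memE[OF that(2)] that(3) sector_disjoint by (metis disjnt_def)
    have "x \<in> \<Union>?P" if "x \<in> \<Omega>" for x
      using sector_cover[OF vV(1) that] f_leaf[OF that] vV(2) by (auto simp: vertex_partition_def)
    then show "\<Union>?P = \<Omega>" using memE sector_subset by blast
  qed
  moreover have "\<exists>A\<in>?P. \<exists>B\<in>?P. A \<noteq> B"
  proof (rule ccontr)
    assume "\<not> ?thesis"
    moreover have "finite ?P"
      using finite_neighbours[OF tree finite_T] by (simp add: vertex_partition_def)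
    ultimately have "card ?P \<le> Suc 0" using card_le_Suc0_iff_eq by blast
    then show False using inner_vertex_degree[OF v] card_vertex_partition by simp
  qed
  moreover have "\<forall>S\<in>?P. D_cut \<Omega> D S" using memE sector_cut by blast
  then have "\<forall>S\<in>?P. \<forall>a\<in>S. \<forall>b\<in>S. \<forall>c\<in>\<Omega> - S. \<forall>d\<in>\<Omega> - S. D a b c d" by (simp add: D_cut_def)
  moreover have "\<not> D a b c d" if "distinct [A, B, C, E]" "A \<in> ?P" "B \<in> ?P" "C \<in> ?P" "E \<in> ?P"
    "a \<in> A" "b \<in> B" "c \<in> C" "d \<in> E" for A B C E a b c d
  proof -
    have on: "v \<in> set (the_path T (f x) (f y))" if "X \<in> ?P" "Y \<in> ?P" "X \<noteq> Y" "x \<in> X" "y \<in> Y" for X Y x y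
      using memE[OF that(1)] memE[OF that(2)] that(3-5) vertex_on_path by blast
    have "v \<in> set (the_path T (f a) (f b))" "v \<in> set (the_path T (f c) (f d))"
      using on[of A B a b] on[of C E c d] that by auto
    then have "\<not> leaf_D T (f a) (f b) (f c) (f d)" unfolding leaf_D_def by blast
    moreover have "a \<in> \<Omega>" "b \<in> \<Omega>" "c \<in> \<Omega>" "d \<in> \<Omega>"
      using that(6-9) memE[OF that(2)] memE[OF that(3)] memE[OF that(4)] memE[OF that(5)] sector_subset
      by blast+
    ultimately show ?thesis using D_iff_leaf_D by simp
  qed
  ultimately show ?thesis unfolding splitting_def by meson
qed

text \<open>The value depends only on \<open>x\<close> and the D-set, so it is the same in every
  representing tree; uniqueness relies on this at the leaves, where no splitting is available. In
  the exceptional case the leaf has no neighbour.\<close>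

lemma leaf_vertex_partition:
  assumes x: "x \<in> \<Omega>"
  shows "vertex_partition (f x) = (if \<Omega> = {x} then {} else {\<Omega> - {x}})"
proof -
  have fx: "f x \<in> vertices T" "degree T (f x) \<le> 1" using f_leaf[OF x] by (auto simp: leaves_def)
  have sec: "sector (f x) w \<subseteq> \<Omega> - {x}" "sector (f x) w \<noteq> {}" if "{f x, w} \<in> edges T" for w
    using branch_self(2)[OF tree that] sector_nonempty[OF that] by (auto simp: sector_def)
  show ?thesis
  proof (cases "\<Omega> = {x}")
    case True
    then have "{w. {f x, w} \<in> edges T} = {}" using sec by blast
    then show ?thesis using True unfolding vertex_partition_def by simp
  next
    case False
    have inj: "f y \<noteq> f x" if "y \<in> \<Omega> - {x}" for y
      using that x bij_leaves by (auto simp: bij_betw_def inj_on_def)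
    obtain y where y: "y \<in> \<Omega> - {x}" using False x by blast
    obtain w where w: "{f x, w} \<in> edges T" using sector_cover[OF fx(1)] inj[OF y] y by blast
    have "card {u. {f x, u} \<in> edges T} \<le> Suc 0"
      using fx(2) degree_eq_card_neighbours[of T "f x"] tree by (simp add: tree_def)
    then have only: "u = w" if "{f x, u} \<in> edges T" for u
      using card_le_Suc0_iff_eq[OF finite_neighbours[OF tree finite_T]] w that by blast
    have "\<Omega> - {x} \<subseteq> sector (f x) w"
      using sector_cover[OF fx(1)] inj only by blast
    then have "sector (f x) w = \<Omega> - {x}" using sec(1)[OF w] by blast
    moreover have "{u. {f x, u} \<in> edges T} = {w}" using only w by blast
    ultimately show ?thesis using False by (simp add: vertex_partition_def)
  qed
qed

lemma bij_vertex_partition: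
  "bij_betw vertex_partition (inner_vertices T) {P. splitting \<Omega> D P \<and> 3 \<le> card P}"
proof (rule bij_betw_imageI)
  show "inj_on vertex_partition (inner_vertices T)"
  proof (rule inj_onI)
    fix u v assume u: "u \<in> inner_vertices T" and eq: "vertex_partition u = vertex_partition v"
    have "vertex_partition u \<noteq> {}"
      using inner_vertex_degree[OF u] card_vertex_partition[of u] by auto
    then obtain S where "S \<in> vertex_partition u" "S \<in> vertex_partition v" using eq by blast
    then show "u = v" using sector_inject unfolding vertex_partition_def by blast
  qed
  show "vertex_partition ` inner_vertices T = {P. splitting \<Omega> D P \<and> 3 \<le> card P}"
  proof (intro equalityI subsetI)
    fix P assume "P \<in> vertex_partition ` inner_vertices T"
    then show "P \<in> {P. splitting \<Omega> D P \<and> 3 \<le> card P}"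
      using splitting_vertex_partition inner_vertex_degree card_vertex_partition by auto
  next
    fix P assume "P \<in> {P. splitting \<Omega> D P \<and> 3 \<le> card P}"
    then have P: "splitting \<Omega> D P" "3 \<le> card P" by auto
    have pP: "partition_on \<Omega> P" using P(1) by (rule splitting_partition)
    obtain P' where "P' \<subseteq> P" "card P' = 3" using P(2) obtain_subset_with_card_n by metis
    then obtain S B C where SBC: "S \<in> P" "B \<in> P" "C \<in> P" "S \<noteq> B" "S \<noteq> C" "B \<noteq> C"
      by (auto simp: card_3_iff)
    obtain v w where vw: "{v, w} \<in> edges T" "S = sector v w"
      using D_cut_is_sector[OF splitting_sector_cut[OF P(1) SBC(1)]] by blast
    have v: "v \<in> vertices T" using tree_edge(2)[OF tree vw(1)] .
    \<comment> \<open>At a leaf the only sector leaves out a single point, which has no room for two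
      disjoint nonempty sectors \<open>B\<close> and \<open>C\<close>.\<close>
    have "v \<notin> leaves T"
    proof
      assume "v \<in> leaves T"
      then obtain x where x: "x \<in> \<Omega>" "v = f x" by (rule leaf_obtain)
      have "S \<in> vertex_partition v" using vw by (auto simp: vertex_partition_def)
      then have S: "S = \<Omega> - {x}" using leaf_vertex_partition[OF x(1)] x(2) by (auto split: if_splits)
      have "B \<inter> S = {}" "C \<inter> S = {}" "B \<subseteq> \<Omega>" "C \<subseteq> \<Omega>" "B \<noteq> {}" "C \<noteq> {}" "B \<inter> C = {}"
        using partition_onD1[OF pP] partition_onD2[OF pP] partition_onD3[OF pP] SBC
        by (auto simp: disjoint_def)
      then show False using S by blast
    qed
    then have v: "v \<in> inner_vertices T" using v by (simp add: inner_vertices_def)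
    have "P = vertex_partition v"
    proof (rule splitting_eq_if_common_sector[OF D P splitting_vertex_partition[OF v] _ SBC(1)])
      show "3 \<le> card (vertex_partition v)"
        using inner_vertex_degree[OF v] card_vertex_partition by simp
      show "S \<in> vertex_partition v" using vw by (auto simp: vertex_partition_def)
    qed
    then show "P \<in> vertex_partition ` inner_vertices T" using v by blast
  qed
qed

text \<open>A pair of complementary cuts comes from one edge in its two directions, so equal pairs
  match in one of two orders, and both orders give the same undirected edge.\<close>

lemma bij_edge_partition:
  "bij_betw (\<lambda>e. induced_partition \<Omega> f (delete_edge T e)) (edges T) {P. splitting \<Omega> D P \<and> card P = 2}"
proof (rule bij_betw_imageI)
  let ?q = "\<lambda>e. induced_partition \<Omega> f (delete_edge T e)"
  have obt: "\<exists>v w. e = {v, w}" if "e \<in> edges T" for e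
    using that edge_obtain tree by (metis tree_def)
  show "inj_on ?q (edges T)"
  proof (rule inj_onI)
    fix e e' assume e: "e \<in> edges T" "e' \<in> edges T" and eq: "?q e = ?q e'"
    obtain v w x y where vw: "e = {v, w}" "e' = {x, y}" using obt e by metis
    have E: "{v, w} \<in> edges T" "{x, y} \<in> edges T" "{y, x} \<in> edges T"
      using e vw by (auto simp: insert_commute)
    have "sector v w = sector x y \<or> sector v w = sector y x"
      using eq induced_partition_delete_edge[OF E(1)] induced_partition_delete_edge[OF E(2)]
      unfolding vw by (metis doubleton_eq_iff)
    then show "e = e'"
      using sector_inject[OF E(1,2)] sector_inject[OF E(1,3)] vw by blast
  qed
  show "?q ` edges T = {P. splitting \<Omega> D P \<and> card P = 2}"
    unfolding splitting_two_iff[OF D]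
  proof (intro equalityI subsetI)
    fix P assume "P \<in> ?q ` edges T"
    then obtain e where e: "e \<in> edges T" "P = ?q e" by blast
    obtain v w where "e = {v, w}" using obt e by blast
    then have "P = {sector v w, \<Omega> - sector v w}" "D_cut \<Omega> D (sector v w)"
      using e induced_partition_delete_edge sector_opposite sector_cut by metis+
    then show "P \<in> {P. \<exists>A. D_cut \<Omega> D A \<and> P = {A, \<Omega> - A}}" by blast
  next
    fix P assume "P \<in> {P. \<exists>A. D_cut \<Omega> D A \<and> P = {A, \<Omega> - A}}"
    then obtain A where A: "D_cut \<Omega> D A" "P = {A, \<Omega> - A}" by blast
    then obtain v w where vw: "{v, w} \<in> edges T" "A = sector v w" using D_cut_is_sector by blast
    then have "P = ?q {v, w}"
      using A induced_partition_delete_edge[OF vw(1)] sector_opposite[OF vw(1)] by simp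
    then show "P \<in> ?q ` edges T" using vw(1) by blast
  qed
qed

text \<open>Complementary sectors at \<open>u\<close> and \<open>v\<close> are the two directions of
  one edge, by \<open>sector_inject\<close>. Adjacency is thereby expressed without the tree and can
  be carried to another one.\<close>

lemma edge_iff_vertex_partition:
  "{u, v} \<in> edges T \<longleftrightarrow> (\<exists>A\<in>vertex_partition u. \<Omega> - A \<in> vertex_partition v)"
proof
  assume e: "{u, v} \<in> edges T"
  have e': "{v, u} \<in> edges T" using e by (simp add: insert_commute)
  have "sector u v \<in> vertex_partition u" "sector v u \<in> vertex_partition v"
    using e e' by (auto simp: vertex_partition_def)
  then show "\<exists>A\<in>vertex_partition u. \<Omega> - A \<in> vertex_partition v"
    using sector_opposite[OF e] by metis
next
  assume "\<exists>A\<in>vertex_partition u. \<Omega> - A \<in> vertex_partition v"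
  then obtain w w' where w: "{u, w} \<in> edges T" "{v, w'} \<in> edges T" "\<Omega> - sector u w = sector v w'"
    by (auto simp: vertex_partition_def)
  have "{w, u} \<in> edges T" using w(1) by (simp add: insert_commute)
  then have "w = v"
    using sector_inject[of w u v w'] w sector_opposite[OF w(1)] by simp
  then show "{u, v} \<in> edges T" using w(1) by simp
qed

end

section \<open>Uniqueness of the representing tree\<close>

lemma represents_unique:
  fixes T1 :: "'v ugraph" and T2 :: "'w ugraph"
  assumes "finite \<Omega>" "D_set \<Omega> D" "represents \<Omega> D T1 f1" "represents \<Omega> D T2 f2"
  shows "\<exists>g. graph_isomorphism T1 T2 g \<and> (\<forall>x\<in>\<Omega>. g (f1 x) = f2 x)"
proof -
  interpret R1: represented_D_set \<Omega> D T1 f1 using assms by unfold_locales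
  interpret R2: represented_D_set \<Omega> D T2 f2 using assms by unfold_locales
  \<comment> \<open>Leaves are matched through the points they represent, inner vertices through
    their splittings. Either way \<open>vertex_partition\<close> is preserved, which determines the
    edges.\<close>
  define g where "g v = (if v \<in> leaves T1 then f2 (inv_into \<Omega> f1 v)
    else inv_into (inner_vertices T2) R2.vertex_partition (R1.vertex_partition v))" for v
  have inj1: "inj_on f1 \<Omega>" using R1.bij_leaves by (simp add: bij_betw_def)
  have gf: "g (f1 x) = f2 x" if "x \<in> \<Omega>" for x
    using R1.f_leaf[OF that] inv_into_f_f[OF inj1 that] by (simp add: g_def)
  have "bij_betw (f2 \<circ> inv_into \<Omega> f1) (leaves T1) (leaves T2)"
    using bij_betw_trans[OF bij_betw_inv_into[OF R1.bij_leaves] R2.bij_leaves] .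
  then have gl: "bij_betw g (leaves T1) (leaves T2)"
    by (rule bij_betw_cong[THEN iffD1, rotated]) (simp add: g_def)
  have "bij_betw (inv_into (inner_vertices T2) R2.vertex_partition \<circ> R1.vertex_partition)
      (inner_vertices T1) (inner_vertices T2)"
    using bij_betw_trans[OF R1.bij_vertex_partition bij_betw_inv_into[OF R2.bij_vertex_partition]] .
  then have gi: "bij_betw g (inner_vertices T1) (inner_vertices T2)"
    by (rule bij_betw_cong[THEN iffD1, rotated]) (simp add: g_def inner_vertices_def)
  have split1: "leaves T1 \<union> inner_vertices T1 = vertices T1"
    and split2: "leaves T2 \<union> inner_vertices T2 = vertices T2" "leaves T2 \<inter> inner_vertices T2 = {}"
    by (auto simp: inner_vertices_def leaves_def)
  have bij: "bij_betw g (vertices T1) (vertices T2)"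
    using bij_betw_combine[OF gl gi split2(2)] split1 split2(1) by simp
  have vp: "R2.vertex_partition (g v) = R1.vertex_partition v" if v: "v \<in> vertices T1" for v
  proof (cases "v \<in> leaves T1")
    case True
    then obtain x where x: "x \<in> \<Omega>" "v = f1 x" by (rule R1.leaf_obtain)
    then show ?thesis using gf R1.leaf_vertex_partition R2.leaf_vertex_partition by simp
  next
    case False
    then have "v \<in> inner_vertices T1" using v by (simp add: inner_vertices_def)
    then have "R1.vertex_partition v \<in> R2.vertex_partition ` inner_vertices T2"
      using R1.bij_vertex_partition R2.bij_vertex_partition by (auto simp: bij_betw_def)
    then show ?thesis using False by (simp add: g_def f_inv_into_f)
  qed
  have "{u, v} \<in> edges T1 \<longleftrightarrow> {g u, g v} \<in> edges T2" if "u \<in> vertices T1" "v \<in> vertices T1" for u v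
    unfolding R1.edge_iff_vertex_partition R2.edge_iff_vertex_partition vp[OF that(1)] vp[OF that(2)] ..
  then show ?thesis using bij gf unfolding graph_isomorphism_def by blast
qed

section \<open>Existence of a representing tree\<close>

text \<open>The Hasse diagram of a family of sets in which every member but the largest has a least
  strict superset. The members are given by labels, so that the vertices can be of any type.\<close>

locale labelled_hasse_tree =
  fixes V :: "'v set" and lab :: "'v \<Rightarrow> 'a set" and root :: 'v and p :: "'v \<Rightarrow> 'v"
  assumes finite_V: "finite V" and root: "root \<in> V" and inj: "inj_on lab V"
    and finite_root: "finite (lab root)" and root_max: "i \<in> V \<Longrightarrow> lab i \<subseteq> lab root"
    and parent: "i \<in> V \<Longrightarrow> i \<noteq> root \<Longrightarrow> p i \<in> V"
    and parent_less: "i \<in> V \<Longrightarrow> i \<noteq> root \<Longrightarrow> lab i \<subset> lab (p i)"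
    and parent_least: "i \<in> V \<Longrightarrow> i \<noteq> root \<Longrightarrow> j \<in> V \<Longrightarrow> lab i \<subset> lab j \<Longrightarrow> lab (p i) \<subseteq> lab j"
begin

definition hasse_graph :: "'v ugraph" where
  "hasse_graph = \<lparr>vertices = V, edges = {{i, p i} |i. i \<in> V \<and> i \<noteq> root}\<rparr>"

lemma vertices_hasse_graph: "vertices hasse_graph = V"
  by (simp add: hasse_graph_def)

lemma edge_iff:
  "{i, j} \<in> edges hasse_graph \<longleftrightarrow> (i \<in> V \<and> i \<noteq> root \<and> j = p i) \<or> (j \<in> V \<and> j \<noteq> root \<and> i = p j)"
  by (auto simp: hasse_graph_def doubleton_eq_iff)

lemma edge_parent: "e \<in> edges hasse_graph \<longleftrightarrow> (\<exists>i. i \<in> V \<and> i \<noteq> root \<and> e = {i, p i})"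
  by (auto simp: hasse_graph_def)

lemma simple: "simple_graph hasse_graph"
  unfolding simple_graph_def
proof
  fix e assume "e \<in> edges hasse_graph"
  then obtain i where i: "i \<in> V" "i \<noteq> root" "e = {i, p i}" by (auto simp: edge_parent)
  then have "i \<noteq> p i" using parent_less[of i] by auto
  then show "e \<subseteq> vertices hasse_graph \<and> card e = 2" using i parent by (simp add: vertices_hasse_graph)
qed

lemma finite_hasse_graph: "finite_graph hasse_graph"
proof -
  have "edges hasse_graph \<subseteq> (\<lambda>i. {i, p i}) ` V" by (auto simp: edge_parent)
  then show ?thesis using finite_V by (auto simp: finite_graph_def vertices_hasse_graph intro: finite_subset)
qed

text \<open>Going down keeps a label below \<open>lab i\<close>. Going up from a label strictly
  below \<open>lab i\<close> does too, since the parent is the least strict superset; only the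
  deleted edge leads out.\<close>

lemma below_closed:
  assumes i: "i \<in> V" "i \<noteq> root" and "conn (delete_edge hasse_graph {i, p i}) x y" "lab x \<subseteq> lab i"
  shows "lab y \<subseteq> lab i"
  using assms(3)
proof (induction rule: conn_induct)
  case start
  show ?case by (rule assms(4))
next
  case (step x y)
  have e: "{x, y} \<in> edges hasse_graph" "{x, y} \<noteq> {i, p i}" using step by (auto simp: delete_edge_def)
  from e(1) consider "x \<in> V" "x \<noteq> root" "y = p x" | "y \<in> V" "y \<noteq> root" "x = p y"
    by (auto simp: edge_iff)
  then show ?case
  proof cases
    case 1
    then have "x \<noteq> i" using e(2) by blast
    then have "lab x \<noteq> lab i" using inj 1 i by (auto simp: inj_on_def)
    then show ?thesis using parent_least[OF 1(1,2) i(1)] step.IH 1(3) by blast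
  next
    case 2
    then show ?thesis using parent_less[OF 2(1,2)] step.IH by blast
  qed
qed

lemma bridge: "i \<in> V \<Longrightarrow> i \<noteq> root \<Longrightarrow> \<not> conn (delete_edge hasse_graph {i, p i}) i (p i)"
  using below_closed[of i i "p i"] parent_less[of i] by blast

lemma conn_root:
  assumes "i \<in> V"
  shows "conn hasse_graph i root"
  using assms
proof (induction "card (lab root) - card (lab i)" arbitrary: i rule: less_induct)
  case less
  show ?case
  proof (cases "i = root")
    case True
    then show ?thesis using root by (auto simp: vertices_hasse_graph intro: conn_refl)
  next
    case False
    note i = less.prems False
    have fin: "finite (lab j)" if "j \<in> V" for j
      using root_max[OF that] finite_root finite_subset by blast
    have "card (lab i) < card (lab (p i))"
      using psubset_card_mono[OF fin[OF parent[OF i]] parent_less[OF i]] .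
    moreover have "card (lab (p i)) \<le> card (lab root)"
      using card_mono[OF finite_root root_max[OF parent[OF i]]] .
    ultimately have "conn hasse_graph (p i) root" using less.hyps[OF _ parent[OF i]] by linarith
    moreover have "conn hasse_graph i (p i)"
      by (rule conn_step[OF conn_refl]) (use i parent[OF i] in \<open>auto simp: vertices_hasse_graph edge_iff\<close>)
    ultimately show ?thesis by (rule conn_trans)
  qed
qed

lemma tree: "tree hasse_graph"
proof (rule tree_if_bridges[OF simple])
  have "conn hasse_graph u v" if "u \<in> V" "v \<in> V" for u v
    using conn_root[OF that(1)] conn_root[OF that(2)] conn_sym conn_trans by metis
  then show "connected_graph hasse_graph" by (simp add: connected_graph_def vertices_hasse_graph conn_def)
  show "\<not> conn (delete_edge hasse_graph {u, v}) u v" if "{u, v} \<in> edges hasse_graph" for u v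
  proof -
    from that consider "u \<in> V" "u \<noteq> root" "v = p u" | "v \<in> V" "v \<noteq> root" "u = p v"
      by (auto simp: edge_iff)
    then show ?thesis
    proof cases
      case 1
      then show ?thesis using bridge by blast
    next
      case 2
      then show ?thesis using bridge[of v] conn_sym[of _ u v] by (auto simp: insert_commute)
    qed
  qed
qed

text \<open>The edge above \<open>i\<close> cuts off exactly the labels contained in
  \<open>lab i\<close>. Such a vertex on the far side would be joined to \<open>p i\<close>, and
  \<open>below_closed\<close> would put the parent below its child.\<close>

lemma conn_delete_iff:
  assumes i: "i \<in> V" "i \<noteq> root" and xy: "x \<in> V" "y \<in> V"
  shows "conn (delete_edge hasse_graph {i, p i}) x y \<longleftrightarrow> (lab x \<subseteq> lab i \<longleftrightarrow> lab y \<subseteq> lab i)"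
proof -
  have e: "{p i, i} \<in> edges hasse_graph" using i by (simp add: edge_iff)
  have "x \<in> branch hasse_graph (p i) i \<longleftrightarrow> lab x \<subseteq> lab i" if x: "x \<in> V" for x
  proof
    assume "x \<in> branch hasse_graph (p i) i"
    then show "lab x \<subseteq> lab i"
      using below_closed[OF i, of i x] by (simp add: branch_def insert_commute)
  next
    assume le: "lab x \<subseteq> lab i"
    show "x \<in> branch hasse_graph (p i) i"
    proof (rule ccontr)
      assume "x \<notin> branch hasse_graph (p i) i"
      then have "x \<in> branch hasse_graph i (p i)" using branch_opposite[OF tree e] x by (simp add: vertices_hasse_graph)
      then have "conn (delete_edge hasse_graph {i, p i}) x (p i)" by (auto simp: branch_def intro: conn_sym)
      then have "lab (p i) \<subseteq> lab i" using below_closed[OF i] le by blast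
      then show False using parent_less[OF i] by blast
    qed
  qed
  then show ?thesis
    using conn_delete_edge_iff[OF tree e, of x y] xy by (simp add: vertices_hasse_graph insert_commute)
qed

lemma neighbours: "{j. {i, j} \<in> edges hasse_graph} = (if i \<in> V \<and> i \<noteq> root then {p i} else {}) \<union> {j \<in> V. j \<noteq> root \<and> p j = i}"
  by (auto simp: edge_iff)

lemma degree_hasse_graph: "degree hasse_graph i = card {j. {i, j} \<in> edges hasse_graph}"
  by (rule degree_eq_card_neighbours[OF simple])

end

section \<open>Construction of a representing tree\<close>

lemma represents_exists:
  assumes fin: "finite \<Omega>" and D: "D_set \<Omega> D"
  shows "\<exists>(T :: nat ugraph) f. represents \<Omega> D T f"
proof (cases "\<Omega> = {}")
  case True
  let ?T = "\<lparr>vertices = {}, edges = {}\<rparr> :: nat ugraph"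
  have "\<not> ucycle ?T q" for q by (auto simp: ucycle_def)
  then have "represents \<Omega> D ?T undefined"
    using True by (auto simp: represents_def tree_def simple_graph_def connected_graph_def
        finite_graph_def D_isomorphism_def leaves_def bij_betw_def)
  then show ?thesis by blast
next
  case False
  then obtain r where r: "r \<in> \<Omega>" by blast
  define H where "H = insert \<Omega> {A. D_cut \<Omega> D A \<and> r \<notin> A}"
  have Hsub: "A \<subseteq> \<Omega>" "A \<noteq> {}" if "A \<in> H" for A using that r by (auto simp: H_def D_cut_def)
  have "finite H" using Hsub(1) fin by (meson finite_Pow_iff finite_subset Pow_iff subsetI)
  \<comment> \<open>Numbers the family, because the tree is to have natural numbers as vertices;
    \<open>h\<close> serves as the labelling.\<close>
  then obtain h where h: "bij_betw h {0..<card H} H" using ex_bij_betw_nat_finite by blast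
  define V where "V = {0..<card H}"
  have hV: "h ` V = H" and hinj: "inj_on h V" using h by (auto simp: V_def bij_betw_def)
  have hH: "h i \<in> H" if "i \<in> V" for i using hV that by blast
  define idx where "idx = inv_into V h"
  have idx: "idx A \<in> V" "h (idx A) = A" if "A \<in> H" for A
    using that hV by (auto simp: idx_def inv_into_into f_inv_into_f)
  have \<Omega>H: "\<Omega> \<in> H" by (simp add: H_def)
  define root where "root = idx \<Omega>"
  have hroot: "root \<in> V" "h root = \<Omega>" using idx[OF \<Omega>H] by (auto simp: root_def)
  have hcut: "D_cut \<Omega> D (h i)" "r \<notin> h i" if "i \<in> V" "i \<noteq> root" for i
  proof -
    have "h i \<noteq> \<Omega>" using that hroot hinj by (auto simp: inj_on_def)
    then show "D_cut \<Omega> D (h i)" "r \<notin> h i" using hH[OF that(1)] by (auto simp: H_def)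
  qed
  have fin_h: "finite (h i)" if "i \<in> V" for i using Hsub(1)[OF hH[OF that]] fin finite_subset by blast
  have single: "{x} \<in> H" if "x \<in> \<Omega>" "x \<noteq> r" for x
    using D_cut_singleton[OF D that(1)] that r by (auto simp: H_def)
  have lam: "h i \<subseteq> h j \<or> h j \<subseteq> h i" if ij: "i \<in> V" "j \<in> V" and a: "a \<in> h i" "a \<in> h j" for i j a
  proof (cases "i = root \<or> j = root")
    case True
    then show ?thesis using hroot(2) Hsub(1) hH ij by blast
  next
    case False
    then show ?thesis
      using D_cut_laminar[OF D hcut(1) hcut(1), of i j a r] hcut(2) ij a r by blast
  qed
  \<comment> \<open>All strict supersets of \<open>h i\<close> share a point of \<open>h i\<close>,
    hence are comparable; one of least cardinality is therefore contained in all of them.\<close>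
  have "\<exists>j. j \<in> V \<and> h i \<subset> h j \<and> (\<forall>k\<in>V. h i \<subset> h k \<longrightarrow> h j \<subseteq> h k)" if i: "i \<in> V" "i \<noteq> root" for i
  proof -
    have "root \<in> V \<and> h i \<subset> h root" using hroot hcut(1)[OF i] by (auto simp: D_cut_def)
    then obtain j where j: "j \<in> V" "h i \<subset> h j"
      and least: "\<And>k. k \<in> V \<Longrightarrow> h i \<subset> h k \<Longrightarrow> card (h j) \<le> card (h k)"
      using ex_has_least_nat[of "\<lambda>j. j \<in> V \<and> h i \<subset> h j" root "\<lambda>j. card (h j)"] by blast
    obtain a where a: "a \<in> h i" using Hsub(2)[OF hH[OF i(1)]] by blast
    have "h j \<subseteq> h k" if k: "k \<in> V" "h i \<subset> h k" for k
    proof -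
      have "h j \<subseteq> h k \<or> h k \<subseteq> h j" using lam[OF j(1) k(1), of a] a j k by blast
      moreover have "h k = h j" if "h k \<subseteq> h j"
        using card_seteq[OF fin_h[OF j(1)] that least[OF k]] .
      ultimately show ?thesis by blast
    qed
    then show ?thesis using j by blast
  qed
  then obtain p where p: "\<And>i. i \<in> V \<Longrightarrow> i \<noteq> root \<Longrightarrow>
      p i \<in> V \<and> h i \<subset> h (p i) \<and> (\<forall>k\<in>V. h i \<subset> h k \<longrightarrow> h (p i) \<subseteq> h k)"
    by metis
  interpret labelled_hasse_tree V h root p
  proof
    show "finite V" by (simp add: V_def)
    show "finite (h root)" using hroot fin by simp
    show "h i \<subseteq> h root" if "i \<in> V" for i using Hsub(1)[OF hH[OF that]] hroot by simp
  qed (use hroot hinj p in blast)+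
  define f where "f x = idx (if x = r then \<Omega> else {x})" for x
  have f: "f x \<in> V" "h (f x) = (if x = r then \<Omega> else {x})" if "x \<in> \<Omega>" for x
    using idx[OF \<Omega>H] idx[OF single] that by (auto simp: f_def)
  have fr: "f r = root" by (simp add: f_def root_def)
  \<comment> \<open>For \<open>x = r\<close> both sides are false: the label of the root is all of
    \<Omega>, and no other label contains \<open>r\<close>.\<close>
  have below: "h (f x) \<subseteq> h i \<longleftrightarrow> x \<in> h i" if "x \<in> \<Omega>" "i \<in> V" "i \<noteq> root" for x i
  proof (cases "x = r")
    case True
    then show ?thesis using hcut[OF that(2,3)] f(2)[OF that(1)] r by auto
  next
    case False
    then show ?thesis using f(2)[OF that(1)] by simp
  qed
  have D_iff: "D a b c d \<longleftrightarrow> leaf_D hasse_graph (f a) (f b) (f c) (f d)"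
    if abcd: "a \<in> \<Omega>" "b \<in> \<Omega>" "c \<in> \<Omega>" "d \<in> \<Omega>" for a b c d
  proof -
    have "leaf_D hasse_graph (f a) (f b) (f c) (f d) \<longleftrightarrow> (\<exists>e\<in>edges hasse_graph. conn (delete_edge hasse_graph e) (f a) (f b)
        \<and> conn (delete_edge hasse_graph e) (f c) (f d) \<and> \<not> conn (delete_edge hasse_graph e) (f a) (f c))"
      by (rule leaf_D_iff_separating_edge[OF tree]) (use f(1) abcd in \<open>simp_all add: vertices_hasse_graph\<close>)
    also have "\<dots> \<longleftrightarrow> (\<exists>i. i \<in> V \<and> i \<noteq> root \<and> conn (delete_edge hasse_graph {i, p i}) (f a) (f b)
        \<and> conn (delete_edge hasse_graph {i, p i}) (f c) (f d) \<and> \<not> conn (delete_edge hasse_graph {i, p i}) (f a) (f c))"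
      unfolding Bex_def edge_parent by blast
    also have "\<dots> \<longleftrightarrow> (\<exists>i. i \<in> V \<and> i \<noteq> root \<and> (a \<in> h i \<longleftrightarrow> b \<in> h i) \<and> (c \<in> h i \<longleftrightarrow> d \<in> h i)
        \<and> \<not> (a \<in> h i \<longleftrightarrow> c \<in> h i))"
      using conn_delete_iff f(1) below abcd by (intro ex_cong1) auto
    also have "\<dots> \<longleftrightarrow> D a b c d"
    proof
      assume "\<exists>i. i \<in> V \<and> i \<noteq> root \<and> (a \<in> h i \<longleftrightarrow> b \<in> h i) \<and> (c \<in> h i \<longleftrightarrow> d \<in> h i)
        \<and> \<not> (a \<in> h i \<longleftrightarrow> c \<in> h i)"
      then obtain i where i: "i \<in> V" "i \<noteq> root" "a \<in> h i \<longleftrightarrow> b \<in> h i" "c \<in> h i \<longleftrightarrow> d \<in> h i"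
        "\<not> (a \<in> h i \<longleftrightarrow> c \<in> h i)" by blast
      show "D a b c d"
      proof (cases "a \<in> h i")
        case True
        then show ?thesis using D_cutD[OF hcut(1)[OF i(1,2)]] i abcd by blast
      next
        case False
        then have "D c d a b" using D_cutD[OF hcut(1)[OF i(1,2)]] i abcd by blast
        then show ?thesis using D_flip[OF D] abcd by blast
      qed
    next
      assume "D a b c d"
      then obtain A where A: "D_cut \<Omega> D A" "a \<in> A" "b \<in> A" "c \<in> \<Omega> - A" "d \<in> \<Omega> - A"
        using D_imp_cut[OF D abcd] by blast
      \<comment> \<open>Of the cut and its complement, the side that avoids \<open>r\<close> is a
        vertex label. Separation does not depend on the side.\<close>
      define B where "B = (if r \<in> A then \<Omega> - A else A)"
      have B: "D_cut \<Omega> D B" "r \<notin> B" using A D_cut_compl[OF D A(1)] by (auto simp: B_def)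
      then have "B \<in> H" by (simp add: H_def)
      then have i: "idx B \<in> V" "h (idx B) = B" using idx by auto
      moreover have "idx B \<noteq> root" using i(2) hroot(2) B(2) r by metis
      moreover have "(a \<in> B \<longleftrightarrow> b \<in> B) \<and> (c \<in> B \<longleftrightarrow> d \<in> B) \<and> \<not> (a \<in> B \<longleftrightarrow> c \<in> B)"
        using A abcd by (auto simp: B_def)
      ultimately show "\<exists>i. i \<in> V \<and> i \<noteq> root \<and> (a \<in> h i \<longleftrightarrow> b \<in> h i) \<and> (c \<in> h i \<longleftrightarrow> d \<in> h i)
        \<and> \<not> (a \<in> h i \<longleftrightarrow> c \<in> h i)" by metis
    qed
    finally show ?thesis by simp
  qed
  have deg_leaf: "degree hasse_graph (f x) \<le> 1" if x: "x \<in> \<Omega>" for x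
  proof (cases "x = r")
    case False
    have "False" if "j \<in> V" "j \<noteq> root" "p j = f x" for j
    proof -
      have "h j \<subset> {x}" using p[OF that(1,2)] that(3) f(2)[OF x] False by simp
      then show False using Hsub(2)[OF hH[OF that(1)]] by blast
    qed
    then have "{j. {f x, j} \<in> edges hasse_graph} \<subseteq> {p (f x)}" unfolding neighbours by auto
    then have "card {j. {f x, j} \<in> edges hasse_graph} \<le> card {p (f x)}" by (rule card_mono[rotated]) simp
    then show ?thesis by (simp add: degree_hasse_graph)
  next
    case True
    \<comment> \<open>This cut contains every label below the root. A strictly smaller label would
      have its parent inside it, so its parent would not be the root.\<close>
    have "h j = \<Omega> - {r}" if j: "j \<in> V" "j \<noteq> root" "p j = root" for j
    proof -
      have hj: "h j \<subseteq> \<Omega> - {r}" using hcut[OF j(1,2)] D_cut_subset by blast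
      have "\<Omega> \<noteq> {r}" using hj Hsub(2)[OF hH[OF j(1)]] by blast
      then have "\<Omega> - {r} \<in> H" using D_cut_compl[OF D D_cut_singleton[OF D r]] by (simp add: H_def)
      then have k: "idx (\<Omega> - {r}) \<in> V" "h (idx (\<Omega> - {r})) = \<Omega> - {r}" using idx by auto
      then have "\<not> h j \<subset> \<Omega> - {r}" using p[OF j(1,2)] j(3) hroot(2) r by fastforce
      then show ?thesis using hj by blast
    qed
    then have "j = idx (\<Omega> - {r})" if "j \<in> V" "j \<noteq> root" "p j = root" for j
      using that hinj by (metis idx_def inv_into_f_f)
    then have "{j. {root, j} \<in> edges hasse_graph} \<subseteq> {idx (\<Omega> - {r})}" unfolding neighbours by auto
    then have "card {j. {root, j} \<in> edges hasse_graph} \<le> card {idx (\<Omega> - {r})}" by (rule card_mono[rotated]) simp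
    then show ?thesis using True fr by (simp add: degree_hasse_graph)
  qed
  have deg_inner: "3 \<le> degree hasse_graph i" if i: "i \<in> V" "i \<notin> f ` \<Omega>" for i
  proof -
    have ir: "i \<noteq> root" using i(2) fr r by blast
    \<comment> \<open>A largest label strictly inside \<open>h i\<close> that contains
      \<open>a\<close> has parent \<open>i\<close>; the singleton of \<open>a\<close> shows that
      candidates exist.\<close>
    have child: "\<exists>j. j \<in> V \<and> j \<noteq> root \<and> p j = i \<and> a \<in> h j" if a: "a \<in> h i" for a
    proof -
      have a\<Omega>: "a \<in> \<Omega>" "a \<noteq> r" using a hcut[OF i(1) ir] D_cut_subset by blast+
      have "f a \<noteq> i" using i(2) a\<Omega> by blast
      then have "h (f a) \<noteq> h i" using f(1)[OF a\<Omega>(1)] i(1) hinj by (auto simp: inj_on_def)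
      then have "f a \<in> V \<and> a \<in> h (f a) \<and> h (f a) \<subset> h i" using f[OF a\<Omega>(1)] a\<Omega> a by auto
      moreover have "\<forall>j. j \<in> V \<and> a \<in> h j \<and> h j \<subset> h i \<longrightarrow> card (h j) < card (h i)"
        using psubset_card_mono[OF fin_h[OF i(1)]] by blast
      ultimately have "\<exists>j. (j \<in> V \<and> a \<in> h j \<and> h j \<subset> h i) \<and>
          (\<forall>k. k \<in> V \<and> a \<in> h k \<and> h k \<subset> h i \<longrightarrow> card (h k) \<le> card (h j))"
        by (rule ex_has_greatest_nat)
      then obtain j where j: "j \<in> V" "a \<in> h j" "h j \<subset> h i"
        and greatest: "\<And>k. k \<in> V \<Longrightarrow> a \<in> h k \<Longrightarrow> h k \<subset> h i \<Longrightarrow> card (h k) \<le> card (h j)"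
        by blast
      have jr: "j \<noteq> root" using j(3) hroot(2) Hsub(1)[OF hH[OF i(1)]] by blast
      note pj = p[OF j(1) jr]
      have "h (p j) \<subseteq> h i" using pj i(1) j(3) by blast
      moreover have "\<not> h (p j) \<subset> h i"
      proof
        assume "h (p j) \<subset> h i"
        then have "card (h (p j)) \<le> card (h j)" using greatest pj j(2) by blast
        then show False using psubset_card_mono[OF fin_h, of "p j" "h j"] pj by simp
      qed
      ultimately have "p j = i" using pj i(1) hinj by (auto simp: inj_on_def)
      then show ?thesis using j jr by blast
    qed
    obtain a where a: "a \<in> h i" using Hsub(2)[OF hH[OF i(1)]] by blast
    obtain j where j: "j \<in> V" "j \<noteq> root" "p j = i" using child[OF a] by blast
    \<comment> \<open>The child \<open>j\<close> misses some point \<open>b\<close> of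
      \<open>h i\<close>, which forces a second child; the parent is the third neighbour.\<close>
    obtain b where b: "b \<in> h i" "b \<notin> h j" using p[OF j(1,2)] j(3) by blast
    obtain k where k: "k \<in> V" "k \<noteq> root" "p k = i" "b \<in> h k" using child[OF b(1)] by blast
    have "h j \<subset> h i" "h k \<subset> h i" "h i \<subset> h (p i)" using p[OF j(1,2)] p[OF k(1,2)] p[OF i(1) ir] j(3) k(3) by auto
    then have "j \<noteq> k" "j \<noteq> p i" "k \<noteq> p i" using b k(4) by blast+
    then have "card {p i, j, k} = 3" by simp
    moreover have "{p i, j, k} \<subseteq> {j. {i, j} \<in> edges hasse_graph}" using i(1) ir j k unfolding neighbours by auto
    then have "card {p i, j, k} \<le> card {j. {i, j} \<in> edges hasse_graph}"
      by (rule card_mono[OF finite_neighbours[OF tree finite_hasse_graph]])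
    ultimately show ?thesis by (simp add: degree_hasse_graph)
  qed
  have leaves: "leaves hasse_graph = f ` \<Omega>"
    using deg_leaf deg_inner f(1) by (fastforce simp: leaves_def vertices_hasse_graph)
  have "inj_on f \<Omega>"
  proof (rule inj_onI)
    fix x y assume xy: "x \<in> \<Omega>" "y \<in> \<Omega>" "f x = f y"
    then have "(if x = r then \<Omega> else {x}) = (if y = r then \<Omega> else {y})" using f(2) by metis
    then show "x = y" using xy r by (auto split: if_splits)
  qed
  then have "D_isomorphism \<Omega> D (leaves hasse_graph) (leaf_D hasse_graph) f"
    using D_iff leaves by (auto simp: D_isomorphism_def bij_betw_def)
  moreover have "degree hasse_graph v \<noteq> 2" if "v \<in> vertices hasse_graph" for v
    using that deg_leaf deg_inner[of v] by (cases "v \<in> f ` \<Omega>") (fastforce simp: vertices_hasse_graph)+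
  ultimately have "represents \<Omega> D hasse_graph f"
    using tree finite_hasse_graph by (simp add: represents_def)
  then show ?thesis by blast
qed

text \<open>A type cannot be quantified existentially, so existence names a concrete vertex type,
  while the other parts hold for arbitrary ones; uniqueness even compares trees over two different
  types.\<close>

theorem mainTheorem10:
  fixes \<Omega> :: "'a set" and D :: "'a \<Rightarrow> 'a \<Rightarrow> 'a \<Rightarrow> 'a \<Rightarrow> bool"
  assumes "finite \<Omega>" and "D_set \<Omega> D"
  shows
    "(\<exists>(T :: nat ugraph) f. represents \<Omega> D T f) \<and>
     (\<forall>(T1 :: 'v ugraph) f1 (T2 :: 'w ugraph) f2.
        represents \<Omega> D T1 f1 \<and> represents \<Omega> D T2 f2 \<longrightarrow>
        (\<exists>g. graph_isomorphism T1 T2 g \<and> (\<forall>x\<in>\<Omega>. g (f1 x) = f2 x))) \<and>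
     (\<forall>(T :: 'v ugraph) f. represents \<Omega> D T f \<longrightarrow>
        bij_betw (\<lambda>\<mu>. induced_partition \<Omega> f (delete_vertex T \<mu>))
          (inner_vertices T) {P. splitting \<Omega> D P \<and> 3 \<le> card P} \<and>
        (\<forall>\<mu>\<in>inner_vertices T.
           card (induced_partition \<Omega> f (delete_vertex T \<mu>)) = degree T \<mu>) \<and>
        bij_betw (\<lambda>\<epsilon>. induced_partition \<Omega> f (delete_edge T \<epsilon>))
          (edges T) {P. splitting \<Omega> D P \<and> card P = 2})"
proof (intro conjI allI impI)
  show "\<exists>(T :: nat ugraph) f. represents \<Omega> D T f"
    using assms by (rule represents_exists)
next
  fix T1 :: "'v ugraph" and f1 and T2 :: "'w ugraph" and f2
  assume "represents \<Omega> D T1 f1 \<and> represents \<Omega> D T2 f2"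
  then show "\<exists>g. graph_isomorphism T1 T2 g \<and> (\<forall>x\<in>\<Omega>. g (f1 x) = f2 x)"
    using represents_unique[OF assms] by blast
next
  fix T :: "'v ugraph" and f
  assume "represents \<Omega> D T f"
  then interpret represented_D_set \<Omega> D T f using assms by unfold_locales
  have eq: "induced_partition \<Omega> f (delete_vertex T \<mu>) = vertex_partition \<mu>"
    if "\<mu> \<in> inner_vertices T" for \<mu>
    using that induced_partition_delete_vertex by (simp add: inner_vertices_def)
  show "bij_betw (\<lambda>\<mu>. induced_partition \<Omega> f (delete_vertex T \<mu>))
      (inner_vertices T) {P. splitting \<Omega> D P \<and> 3 \<le> card P}"
    by (subst bij_betw_cong[OF eq]) (simp_all add: bij_vertex_partition)
  show "\<forall>\<mu>\<in>inner_vertices T. card (induced_partition \<Omega> f (delete_vertex T \<mu>)) = degree T \<mu>"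
    using eq card_vertex_partition by simp
  show "bij_betw (\<lambda>\<epsilon>. induced_partition \<Omega> f (delete_edge T \<epsilon>))
      (edges T) {P. splitting \<Omega> D P \<and> card P = 2}"
    by (rule bij_edge_partition)
qed

end
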